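(* Let $H$ be an infinite-dimensional separable complex Hilbert space. Then the set of operators in $\mathcal{M}_r(H)$ which have an invariant half-space is dense in $\mathcal{B}(H)$ with respect to the operator norm.
   Context: $\mathcal{B}(H)$ denotes the bounded linear operators on $H$. For a nonzero Hilbert space $M$ and $A\in\mathcal{B}(M)$, the minimum modulus is $m(A)=\inf\{\|Ax\|: x\in M,\ \|x\|=1\}$; $A$ is minimum attaining if there is a unit vector $x_0\in M$ with $\|Ax_0\|=m(A)$. A closed subspace $M\subseteq H$ reduces $T\in\mathcal{B}(H)$ if $T(M)\subseteq M$ and $T^*(M)\subseteq M$. $\mathcal{M}_r(H)$ is the set of all $T\in\mathcal{B}(H)$ such that for every nonzero closed subspace $M$ reducing $T$, the restriction $T|_M:M\to M$ is minimum attaining. A half-space of $H$ is a closed subspace $Y\subseteq H$ such that both $Y$ and the quotient $H/Y$ are infinite-dimensional; it is invariant for $T$ if $T(Y)\subseteq Y$. *)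

theory Defs
  imports "HOL-Analysis.Analysis"
begin

class complex_vector = real_vector +
  fixes scaleC :: "complex \<Rightarrow> 'a \<Rightarrow> 'a"  (infixr \<open>*\<^sub>C\<close> 75)
  assumes scaleC_add_right: "c *\<^sub>C (x + y) = c *\<^sub>C x + c *\<^sub>C y"
    and scaleC_add_left: "(c + d) *\<^sub>C x = c *\<^sub>C x + d *\<^sub>C x"
    and scaleC_scaleC: "c *\<^sub>C (d *\<^sub>C x) = (c * d) *\<^sub>C x"
    and scaleR_conv_scaleC: "r *\<^sub>R x = of_real r *\<^sub>C x"

global_interpretation complex_vector:
  vector_space "scaleC :: complex \<Rightarrow> 'a \<Rightarrow> 'a::complex_vector"
proof
  show "1 *\<^sub>C x = x" for x :: 'a
    using scaleR_conv_scaleC[of 1 x] by simp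
qed (simp_all add: scaleC_add_right scaleC_add_left scaleC_scaleC)

text \<open>
  The inherited real inner product is the real part of the complex one, so the inherited norm
  (hence also the topology and completeness) is the usual one; see \<open>norm_eq_sqrt_cinner\<close>.
\<close>

class complex_inner = complex_vector + real_inner +
  fixes cinner :: "'a \<Rightarrow> 'a \<Rightarrow> complex"
  assumes cinner_add_left: "cinner (x + y) z = cinner x z + cinner y z"
    and cinner_scaleC_left: "cinner (c *\<^sub>C x) y = c * cinner x y"
    and cinner_commute: "cinner x y = cnj (cinner y x)"
    and Re_cinner: "Re (cinner x y) = x \<bullet> y"

lemma cinner_self: "cinner x x = of_real (x \<bullet> x)"
  using cinner_commute[of x x] Re_cinner[of x x] by (simp add: complex_eq_iff)

lemma norm_eq_sqrt_cinner: "norm x = sqrt (Re (cinner x x))"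
  by (simp add: Re_cinner norm_eq_sqrt_inner)

class complex_hilbert = complex_inner + banach

definition separable :: "'a::topological_space set \<Rightarrow> bool" where
  "separable S \<longleftrightarrow> (\<exists>D. countable D \<and> D \<subseteq> S \<and> S \<subseteq> closure D)"

definition infinite_dim :: "'a::complex_vector set \<Rightarrow> bool" where
  "infinite_dim V \<longleftrightarrow> \<not> (\<exists>B. finite B \<and> B \<subseteq> V \<and> complex_vector.span B = V)"

text \<open>
  The quotient of the whole space by a subspace \<open>Y\<close> is the set of cosets of \<open>Y\<close>; its linear
  structure is given on representatives by \<open>[x] + [y] = [x + y]\<close> and \<open>c [x] = [c x]\<close>.
\<close>

definition coset :: "'a::complex_vector set \<Rightarrow> 'a \<Rightarrow> 'a set" where
  "coset Y x = (\<lambda>y. x + y) ` Y"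

definition quotient_space :: "'a::complex_vector set \<Rightarrow> 'a set set" where
  "quotient_space Y = range (coset Y)"

inductive_set quotient_span :: "'a::complex_vector set \<Rightarrow> 'a set set \<Rightarrow> 'a set set"
  for Y :: "'a set" and S :: "'a set set" where
  zero: "coset Y 0 \<in> quotient_span Y S"
| step: "coset Y x \<in> S \<Longrightarrow> coset Y y \<in> quotient_span Y S
         \<Longrightarrow> coset Y (c *\<^sub>C x + y) \<in> quotient_span Y S"

definition infinite_dim_quotient :: "'a::complex_vector set \<Rightarrow> bool" where
  "infinite_dim_quotient Y \<longleftrightarrow>
     \<not> (\<exists>S. finite S \<and> S \<subseteq> quotient_space Y \<and> quotient_span Y S = quotient_space Y)"

definition closed_csubspace :: "'a::complex_hilbert set \<Rightarrow> bool" where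
  "closed_csubspace M \<longleftrightarrow> complex_vector.subspace M \<and> closed M"

definition half_space :: "'a::complex_hilbert set \<Rightarrow> bool" where
  "half_space Y \<longleftrightarrow> closed_csubspace Y \<and> infinite_dim Y \<and> infinite_dim_quotient Y"

text \<open>
  \<open>\<B>(H)\<close>: the complex-linear elements of the library type of bounded real-linear maps, whose
  norm is the operator norm.
\<close>

definition bounded_ops :: "('a::complex_hilbert \<Rightarrow>\<^sub>L 'a) set" where
  "bounded_ops = {T. Vector_Spaces.linear scaleC scaleC (blinfun_apply T)}"

definition cadjoint :: "('a::complex_hilbert \<Rightarrow>\<^sub>L 'a) \<Rightarrow> 'a \<Rightarrow>\<^sub>L 'a" where
  "cadjoint T =
     (THE S. S \<in> bounded_ops \<and>
             (\<forall>x y. cinner (blinfun_apply T x) y = cinner x (blinfun_apply S y)))"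

definition has_invariant_half_space :: "('a::complex_hilbert \<Rightarrow>\<^sub>L 'a) \<Rightarrow> bool" where
  "has_invariant_half_space T \<longleftrightarrow> (\<exists>Y. half_space Y \<and> blinfun_apply T ` Y \<subseteq> Y)"

definition reduces :: "'a::complex_hilbert set \<Rightarrow> ('a \<Rightarrow>\<^sub>L 'a) \<Rightarrow> bool" where
  "reduces M T \<longleftrightarrow> closed_csubspace M \<and>
     blinfun_apply T ` M \<subseteq> M \<and> blinfun_apply (cadjoint T) ` M \<subseteq> M"

text \<open>
  For the restriction of an operator to an invariant subspace \<open>M\<close>, only its values on the unit
  sphere of \<open>M\<close> matter; \<open>M\<close> is assumed nonzero, so that this sphere is not empty.
\<close>

definition min_modulus_on :: "'a::complex_hilbert set \<Rightarrow> ('a \<Rightarrow> 'a) \<Rightarrow> real" where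
  "min_modulus_on M A = (INF x\<in>{x \<in> M. norm x = 1}. norm (A x))"

definition min_attaining_on :: "'a::complex_hilbert set \<Rightarrow> ('a \<Rightarrow> 'a) \<Rightarrow> bool" where
  "min_attaining_on M A \<longleftrightarrow> (\<exists>x0\<in>M. norm x0 = 1 \<and> norm (A x0) = min_modulus_on M A)"

definition reducing_min_attaining_ops :: "('a::complex_hilbert \<Rightarrow>\<^sub>L 'a) set"  (\<open>\<M>\<^sub>r\<close>) where
  "\<M>\<^sub>r = {T \<in> bounded_ops.
     \<forall>M. reduces M T \<and> M \<noteq> {0} \<longrightarrow> min_attaining_on M (blinfun_apply T)}"

end

theory Submission
  imports Defs "HOL-Complex_Analysis.Cauchy_Integral_Formula"
begin

text \<open>
  If the modulus of \<open>S\<close> has finite spectrum, then \<open>S\<close> lies in \<open>\<M>\<^sub>r\<close>: the projection onto a reducing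
  subspace commutes with \<open>S\<^sup>*S\<close>, so the subspace is spanned by its eigenvectors of \<open>S\<^sup>*S\<close>. Rounding the
  modulus of \<open>T\<close> by spectral projections gives such an \<open>S\<close> near \<open>T\<close>. If \<open>S\<close> has infinite-dimensional
  kernel, half of the kernel is an invariant half-space. Otherwise \<open>S\<close> has a small perturbation
  \<open>S - K\<close> that leaves a half-space \<open>L\<close> invariant and agrees with \<open>S\<close> on the kernel of \<open>S\<close>. Since \<open>S\<close> is
  bounded below off its kernel, \<open>S - K = W S\<close> with \<open>W\<close> near the identity, and \<open>W\<close> can be replaced by an
  isometry \<open>U\<close> near the identity that still maps \<open>W\<^sup>-\<^sup>1 L\<close> into \<open>L\<close>. Then \<open>U S\<close> leaves \<open>L\<close> invariant and has
  the same modulus as \<open>S\<close>.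
\<close>

section \<open>Real Hilbert spaces\<close>

text \<open>Everything up to the complex section uses only the real inner product. Complex linearity
  is the same as commuting with \<open>cmul \<i>\<close>, so the spectral constructions carry a
  clause saying that they commute with whatever commutes with their data, and complex linearity of
  the results is read off from it. \<open>U\<close> has to be an isometry because \<open>W S\<close>
  in place of \<open>U S\<close> could change the modulus and destroy its finite spectrum. The
  factor \<open>W\<close> exists because the rounding leaves no small positive eigenvalue:
  \<open>S\<close> then has a generalized inverse \<open>S'\<close> with \<open>S S' S = S\<close>,
  and since \<open>K\<close> vanishes on the kernel, \<open>K = J S\<close> for
  \<open>J = K S'\<close>, which gives \<open>W = id - J\<close>. As \<open>S'\<close> may be large,
  it is fixed first and the size of \<open>K\<close> is chosen relative to its norm. The
  triangularizing vectors are taken orthogonal to the kernel and to finitely many earlier vectors.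
  With a finite-dimensional kernel they never run out; the complement of an infinite-dimensional
  kernel may be too small, hence the case split.\<close>

lemma norm_times_norm: "norm x * norm x = x \<bullet> x" for x :: "'a::real_inner"
  by (metis power2_eq_square power2_norm_eq_inner)

text \<open>The midpoint of two members of a minimizing sequence stays in the convex set, so it
  cannot beat the infimum; the parallelogram law then forces the sequence to be Cauchy.\<close>

lemma nearest_point_exists:
  fixes S :: "'a::{real_inner,banach} set"
  assumes "convex S" "closed S" "S \<noteq> {}"
  shows "\<exists>p\<in>S. \<forall>y\<in>S. dist x p \<le> dist x y"
proof -
  define d where "d = infdist x S"
  have d0: "0 \<le> d" by (simp add: d_def infdist_nonneg)
  have dle: "d \<le> dist x y" if "y \<in> S" for y
    using that by (simp add: d_def infdist_le)
  \<comment> \<open>The error is imposed on the squares because the parallelogram law compares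
    squares.\<close>
  have "\<exists>y\<in>S. (dist x y)\<^sup>2 < d\<^sup>2 + 1 / real (Suc n)" for n
  proof -
    have "d < sqrt (d\<^sup>2 + 1 / real (Suc n))"
      by (rule real_less_rsqrt) simp
    then have "Inf (dist x ` S) < sqrt (d\<^sup>2 + 1 / real (Suc n))"
      using assms(3) by (simp add: d_def infdist_def)
    then obtain y where y: "y \<in> S" "dist x y < sqrt (d\<^sup>2 + 1 / real (Suc n))"
      using cInf_lessD[of "dist x ` S"] assms(3) by blast
    have "(dist x y)\<^sup>2 < (sqrt (d\<^sup>2 + 1 / real (Suc n)))\<^sup>2"
      using y(2) by (intro power_strict_mono) auto
    then show ?thesis using y(1) by (intro bexI[of _ y]) simp_all
  qed
  then obtain y where y: "\<And>n. y n \<in> S" "\<And>n. (dist x (y n))\<^sup>2 < d\<^sup>2 + 1 / real (Suc n)"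
    by metis
  have par: "(dist (y m) (y n))\<^sup>2 \<le> 2 / real (Suc m) + 2 / real (Suc n)" for m n
  proof -
    have "(1/2) *\<^sub>R y m + (1/2) *\<^sub>R y n \<in> S"
      using assms(1) y(1) by (auto intro!: convexD)
    then have "d\<^sup>2 \<le> (dist x ((1/2) *\<^sub>R y m + (1/2) *\<^sub>R y n))\<^sup>2"
      using dle d0 by (meson power_mono)
    moreover have "(dist (y m) (y n))\<^sup>2 + 4 * (dist x ((1/2) *\<^sub>R y m + (1/2) *\<^sub>R y n))\<^sup>2
        = 2 * (dist x (y m))\<^sup>2 + 2 * (dist x (y n))\<^sup>2"
    proof -
      define u v where "u = x - y m" and "v = x - y n"
      have "dist (y m) (y n) = norm (u - v)"
        by (simp add: dist_norm u_def v_def norm_minus_commute)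
      moreover have "x - ((1/2) *\<^sub>R y m + (1/2) *\<^sub>R y n) = (1/2) *\<^sub>R (u + v)"
        by (simp add: u_def v_def algebra_simps flip: scaleR_2)
      moreover have "(norm (u - v))\<^sup>2 + (norm (u + v))\<^sup>2 = 2 * (norm u)\<^sup>2 + 2 * (norm v)\<^sup>2"
        by (simp add: power2_norm_eq_inner inner_add_left inner_add_right inner_diff_left
            inner_diff_right inner_commute)
      ultimately show ?thesis by (simp add: dist_norm u_def v_def power_divide)
    qed
    ultimately show ?thesis using y(2)[of m] y(2)[of n] by simp
  qed
  have "Cauchy y"
  proof (rule metric_CauchyI)
    fix e :: real assume e: "0 < e"
    obtain N where N: "inverse (real (Suc N)) < e\<^sup>2 / 4"
      using reals_Archimedean[of "e\<^sup>2 / 4"] e by auto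
    have b: "1 / real (Suc k) < e\<^sup>2 / 4" if "k \<ge> N" for k
    proof -
      have "1 / real (Suc k) \<le> 1 / real (Suc N)" using that by (simp add: field_simps)
      then show ?thesis using N by (simp add: inverse_eq_divide)
    qed
    have "dist (y m) (y n) < e" if "m \<ge> N" "n \<ge> N" for m n
    proof -
      have "(dist (y m) (y n))\<^sup>2 < e\<^sup>2" using par[of m n] b[OF that(1)] b[OF that(2)] by simp
      then show ?thesis by (rule power_less_imp_less_base) (use e in simp)
    qed
    then show "\<exists>M. \<forall>m\<ge>M. \<forall>n\<ge>M. dist (y m) (y n) < e" by blast
  qed
  then obtain p where p: "y \<longlonglongrightarrow> p" using Cauchy_convergent convergent_def by blast
  have pS: "p \<in> S" using assms(2) p y(1) closed_sequentially by blast
  have "(\<lambda>n. (dist x (y n))\<^sup>2) \<longlonglongrightarrow> (dist x p)\<^sup>2" by (intro tendsto_intros p)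
  moreover have "(\<lambda>n. d\<^sup>2 + 1 / real (Suc n)) \<longlonglongrightarrow> d\<^sup>2 + 0"
    by (intro tendsto_add tendsto_const LIMSEQ_Suc[OF lim_1_over_n])
  ultimately have "(dist x p)\<^sup>2 \<le> d\<^sup>2 + 0"
    by (rule LIMSEQ_le) (use y(2) less_imp_le in blast)
  then have "dist x p \<le> d" by (intro power2_le_imp_le[OF _ d0]) simp
  then show ?thesis using pS dle order_trans by blast
qed

text \<open>At the nearest point the residual forms no acute angle with any direction of
  \<open>M\<close>; applying this to \<open>y\<close> and \<open>- y\<close> gives
  orthogonality.\<close>

lemma orthogonal_decomposition_exists:
  fixes M :: "'a::{real_inner,banach} set"
  assumes "subspace M" "closed M"
  shows "\<exists>p\<in>M. \<forall>y\<in>M. (x - p) \<bullet> y = 0"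
proof -
  obtain p where p: "p \<in> M" "\<forall>y\<in>M. dist x p \<le> dist x y"
    using nearest_point_exists[of M x] assms subspace_imp_convex subspace_0 by blast
  have le: "(x - p) \<bullet> y \<le> 0" if "y \<in> M" for y
    using any_closest_point_dot[of M p "p + y" x] subspace_imp_convex[OF assms(1)] assms p that
    by (simp add: subspace_add)
  have "(x - p) \<bullet> y = 0" if "y \<in> M" for y
    using le[OF that] le[of "- y"] that assms by (simp add: subspace_neg)
  then show ?thesis using p(1) by blast
qed

text \<open>Bundled as a bounded operator from the start; it is the orthogonal projection once
  \<open>M\<close> is a closed subspace.\<close>

definition proj :: "'a::{real_inner,banach} set \<Rightarrow> 'a \<Rightarrow>\<^sub>L 'a" where
  "proj M = Blinfun (\<lambda>x. SOME p. p \<in> M \<and> (\<forall>y\<in>M. (x - p) \<bullet> y = 0))"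

context
  fixes M :: "'a::{real_inner,banach} set"
  assumes M: "subspace M" "closed M"
begin

lemma proj_unique_aux:
  assumes "p \<in> M" "\<forall>y\<in>M. (x - p) \<bullet> y = 0" "q \<in> M" "\<forall>y\<in>M. (x - q) \<bullet> y = 0"
  shows "p = q"
proof -
  have "p - q \<in> M" using assms M by (simp add: subspace_diff)
  then have "(p - q) \<bullet> (p - q) = 0"
    using assms by (metis (no_types, lifting) diff_self inner_diff_left eq_iff_diff_eq_0)
  then show ?thesis by simp
qed

lemma proj_props: "blinfun_apply (proj M) x \<in> M" "\<And>y. y \<in> M \<Longrightarrow> (x - proj M x) \<bullet> y = 0"
proof -
  define f where "f = (\<lambda>x. SOME p. p \<in> M \<and> (\<forall>y\<in>M. (x - p) \<bullet> y = 0))"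
  have f: "f x \<in> M \<and> (\<forall>y\<in>M. (x - f x) \<bullet> y = 0)" for x
    unfolding f_def by (rule someI_ex) (use orthogonal_decomposition_exists[OF M, of x] in blast)
  have uniq: "f x = p" if "p \<in> M" "\<forall>y\<in>M. (x - p) \<bullet> y = 0" for x p
    using proj_unique_aux f that by blast
  have "bounded_linear f"
  proof (rule bounded_linear_intro[where K = 1])
    show "f (x + y) = f x + f y" for x y
      using f[of x] f[of y] M by (intro uniq) (auto simp: subspace_add inner_simps)
    show "f (r *\<^sub>R x) = r *\<^sub>R f x" for r x
      using f[of x] M by (intro uniq) (auto simp: subspace_scale inner_simps simp flip: scaleR_diff_right)
    show "norm (f x) \<le> norm x * 1" for x
    proof -
      have "(x - f x) \<bullet> f x = 0" using f by blast
      then have "norm (f x) * norm (f x) = x \<bullet> f x"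
        by (simp add: norm_times_norm inner_diff_left)
      also have "\<dots> \<le> norm x * norm (f x)" by (rule norm_cauchy_schwarz)
      finally show ?thesis by (cases "f x = 0") simp_all
    qed
  qed
  then have "blinfun_apply (proj M) = f"
    by (simp add: proj_def f_def bounded_linear_Blinfun_apply)
  then show "blinfun_apply (proj M) x \<in> M" "\<And>y. y \<in> M \<Longrightarrow> (x - proj M x) \<bullet> y = 0"
    using f by auto
qed

lemma proj_unique:
  assumes "p \<in> M" "\<And>y. y \<in> M \<Longrightarrow> (x - p) \<bullet> y = 0"
  shows "proj M x = p"
  using proj_unique_aux[of "proj M x" x p] proj_props assms by blast

lemma proj_ident: "x \<in> M \<Longrightarrow> proj M x = x"
  by (rule proj_unique) auto

lemma proj_sym: "proj M x \<bullet> y = x \<bullet> proj M y"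
proof -
  have "(x - proj M x) \<bullet> proj M y = 0" "(y - proj M y) \<bullet> proj M x = 0"
    using proj_props by auto
  then show ?thesis by (simp add: inner_diff_left inner_diff_right inner_commute)
qed

lemma norm_proj_le: "norm (proj M x) \<le> norm x"
proof -
  have "norm (proj M x) * norm (proj M x) = x \<bullet> proj M x"
    using proj_sym[of x "proj M x"] proj_ident[OF proj_props(1)]
    by (simp add: norm_times_norm)
  also have "\<dots> \<le> norm x * norm (proj M x)" by (rule norm_cauchy_schwarz)
  finally show ?thesis by (cases "proj M x = 0") auto
qed

end

text \<open>The kernel is a closed hyperplane, so a vector \<open>w\<close> orthogonal to it and
  outside it represents \<open>f\<close> after rescaling: \<open>x - (f x / f w) w\<close> always
  lies in the kernel.\<close>

lemma riesz_representation:
  fixes f :: "'a::{real_inner,banach} \<Rightarrow> real"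
  assumes "bounded_linear f"
  shows "\<exists>z. \<forall>x. f x = x \<bullet> z"
proof (cases "\<forall>x. f x = 0")
  case True
  then show ?thesis by (intro exI[of _ 0]) auto
next
  case False
  interpret bounded_linear f by fact
  define M where "M = {x. f x = 0}"
  have M: "subspace M" "closed M"
    by (auto simp: M_def subspace_def add scaleR zero
        intro!: closed_Collect_eq continuous_on continuous_intros)
  obtain x0 where x0: "f x0 \<noteq> 0" using False by blast
  define w where "w = x0 - proj M x0"
  have fw: "f w \<noteq> 0" using proj_props(1)[OF M, of x0] x0 by (simp add: w_def diff M_def)
  have "f x = x \<bullet> ((f w / (w \<bullet> w)) *\<^sub>R w)" for x
  proof -
    have "x - (f x / f w) *\<^sub>R w \<in> M" using fw by (simp add: M_def diff scaleR)
    then have "w \<bullet> (x - (f x / f w) *\<^sub>R w) = 0" using proj_props(2)[OF M] by (simp add: w_def)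
    moreover have "w \<bullet> w \<noteq> 0" using fw zero by auto
    ultimately show ?thesis using fw by (simp add: inner_simps inner_commute field_simps)
  qed
  then show ?thesis by blast
qed

text \<open>The adjoint for the real inner product. On complex-linear operators it agrees with the
  complex adjoint, see \<open>cadjoint_eq\<close>.\<close>

definition adj :: "('a::{real_inner,banach} \<Rightarrow>\<^sub>L 'a) \<Rightarrow> 'a \<Rightarrow>\<^sub>L 'a" where
  "adj T = Blinfun (\<lambda>y. SOME z. \<forall>x. T x \<bullet> y = x \<bullet> z)"

lemma adj: "blinfun_apply T x \<bullet> y = x \<bullet> adj T y"
proof -
  define f where "f = (\<lambda>y. SOME z. \<forall>x. T x \<bullet> y = x \<bullet> z)"
  have f: "T x \<bullet> y = x \<bullet> f y" for x y
  proof -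
    have "bounded_linear (\<lambda>x. T x \<bullet> y)"
      by (rule bounded_linear_compose[OF bounded_linear_inner_left blinfun.bounded_linear_right])
    then have "\<exists>z. \<forall>x. T x \<bullet> y = x \<bullet> z" by (rule riesz_representation)
    then have "\<forall>x. T x \<bullet> y = x \<bullet> f y" unfolding f_def by (rule someI_ex)
    then show ?thesis by blast
  qed
  have "bounded_linear f"
  proof (rule bounded_linear_intro[where K = "norm T"])
    show "f (x + y) = f x + f y" for x y
      by (subst vector_eq_ldot[symmetric]) (simp add: inner_add_right flip: f)
    show "f (r *\<^sub>R x) = r *\<^sub>R f x" for r x
      by (subst vector_eq_ldot[symmetric]) (simp flip: f)
    show "norm (f x) \<le> norm x * norm T" for x
    proof -
      have "norm (f x) * norm (f x) = T (f x) \<bullet> x"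
        by (simp add: f norm_times_norm)
      also have "\<dots> \<le> norm (T (f x)) * norm x" by (rule norm_cauchy_schwarz)
      also have "\<dots> \<le> (norm T * norm (f x)) * norm x"
        by (intro mult_right_mono norm_blinfun) auto
      finally show ?thesis by (cases "f x = 0") (auto simp: mult_ac)
    qed
  qed
  then have "blinfun_apply (adj T) = f"
    by (simp add: adj_def f_def bounded_linear_Blinfun_apply)
  then show ?thesis using f by simp
qed

lemma adj_left: "adj T x \<bullet> y = x \<bullet> blinfun_apply T y"
  by (metis adj inner_commute)

lemma adj_unique: "(\<And>x y. blinfun_apply T x \<bullet> y = x \<bullet> blinfun_apply S y) \<Longrightarrow> adj T = S"
  by (intro blinfun_eqI, subst vector_eq_ldot[symmetric]) (simp flip: adj)

lemma adj_adj [simp]: "adj (adj T) = T"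
  by (rule adj_unique) (rule adj_left)

lemma adj_compose: "adj (S o\<^sub>L T) = adj T o\<^sub>L adj S"
  by (rule adj_unique) (simp add: adj)

lemma adj_diff: "adj (S - T) = adj S - adj T"
  by (rule adj_unique) (simp add: adj blinfun.bilinear_simps inner_simps)

lemma adj_id [simp]: "adj id_blinfun = id_blinfun"
  by (rule adj_unique) simp

lemma norm_adj_le: "norm (adj T) \<le> norm T"
proof (rule norm_blinfun_bound)
  fix x
  have "norm (adj T x) * norm (adj T x) = T (adj T x) \<bullet> x"
    by (simp add: adj norm_times_norm)
  also have "\<dots> \<le> norm (T (adj T x)) * norm x" by (rule norm_cauchy_schwarz)
  also have "\<dots> \<le> (norm T * norm (adj T x)) * norm x"
    by (intro mult_right_mono norm_blinfun) auto
  finally show "norm (adj T x) \<le> norm T * norm x" by (cases "adj T x = 0") (auto simp: mult_ac)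
qed simp

lemma adj_proj: "subspace M \<Longrightarrow> closed M \<Longrightarrow> adj (proj M) = proj M"
  by (rule adj_unique) (rule proj_sym)

section \<open>Inverses, square roots and spectral projections\<close>

definition commutes :: "('a::real_normed_vector \<Rightarrow>\<^sub>L 'a) \<Rightarrow> ('a \<Rightarrow>\<^sub>L 'a) \<Rightarrow> bool" where
  "commutes X Y \<longleftrightarrow> X o\<^sub>L Y = Y o\<^sub>L X"

lemma commutes_apply: "commutes X Y \<Longrightarrow> blinfun_apply X (blinfun_apply Y x) = Y (X x)"
  by (metis commutes_def blinfun_apply_blinfun_compose)

lemma commutesI: "(\<And>x. blinfun_apply X (blinfun_apply Y x) = Y (X x)) \<Longrightarrow> commutes X Y"
  unfolding commutes_def by (rule blinfun_eqI) simp

lemma commutes_sym: "commutes X Y \<longleftrightarrow> commutes Y X"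
  by (auto simp: commutes_def)

lemma commutes_id [simp]: "commutes X id_blinfun"
  by (rule commutesI) simp

lemma commutes_refl [simp]: "commutes X X"
  by (simp add: commutes_def)

lemma commutes_compose: "commutes X Y \<Longrightarrow> commutes X Z \<Longrightarrow> commutes X (Y o\<^sub>L Z)"
  by (rule commutesI) (simp add: commutes_apply[of X])

lemma commutes_add: "commutes X Y \<Longrightarrow> commutes X Z \<Longrightarrow> commutes X (Y + Z)"
  by (rule commutesI) (simp add: commutes_apply[of X] blinfun.bilinear_simps)

lemma commutes_diff: "commutes X Y \<Longrightarrow> commutes X Z \<Longrightarrow> commutes X (Y - Z)"
  by (rule commutesI) (simp add: commutes_apply[of X] blinfun.bilinear_simps)

lemma commutes_scaleR: "commutes X Y \<Longrightarrow> commutes X (c *\<^sub>R Y)"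
  by (rule commutesI) (simp add: commutes_apply[of X] blinfun.bilinear_simps)

lemma commutes_adj: "commutes X Y \<Longrightarrow> commutes (adj X) (adj Y)"
  by (simp add: commutes_def flip: adj_compose)

lemma commutes_inverse:
  assumes "commutes X H" "V o\<^sub>L H = id_blinfun" "H o\<^sub>L V = id_blinfun"
  shows "commutes X V"
proof (rule commutesI)
  fix x
  have VH: "V (H z) = z" and HV: "H (V z) = z" for z
    using assms(2,3) by (metis blinfun_apply_blinfun_compose blinfun_apply_id_blinfun id_apply)+
  have "X (V x) = V (H (X (V x)))" by (simp add: VH)
  also have "H (X (V x)) = X (H (V x))" using commutes_apply[OF assms(1)] by simp
  finally show "X (V x) = V (X x)" by (simp add: HV)
qed

lemma adj_scaleR: "adj (c *\<^sub>R T) = c *\<^sub>R adj T"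
  by (rule adj_unique) (simp add: adj blinfun.bilinear_simps)

lemma adj_add: "adj (S + T) = adj S + adj T"
  by (rule adj_unique) (simp add: adj blinfun.bilinear_simps inner_simps)

lemma adj_inverse:
  assumes "adj H = H" "V o\<^sub>L H = id_blinfun" "H o\<^sub>L V = id_blinfun"
  shows "adj V = V"
proof (rule adj_unique)
  fix x y
  have VH: "V (H z) = z" and HV: "H (V z) = z" for z
    using assms(2,3) by (metis blinfun_apply_blinfun_compose blinfun_apply_id_blinfun id_apply)+
  have "V x \<bullet> y = V x \<bullet> H (V y)" by (simp add: HV)
  also have "\<dots> = H (V x) \<bullet> V y" using assms(1) by (simp add: adj)
  finally show "V x \<bullet> y = x \<bullet> V y" by (simp add: HV)
qed

lemma adj_tendsto:
  assumes "Y \<longlonglongrightarrow> L" "\<And>n. adj (Y n) = Y n"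
  shows "adj L = L"
proof (rule adj_unique)
  fix x y
  have "(\<lambda>n. Y n x \<bullet> y) \<longlonglongrightarrow> L x \<bullet> y" "(\<lambda>n. x \<bullet> Y n y) \<longlonglongrightarrow> x \<bullet> L y"
    by (intro tendsto_intros assms(1))+
  moreover have "Y n x \<bullet> y = x \<bullet> Y n y" for n by (simp add: adj assms(2))
  ultimately show "L x \<bullet> y = x \<bullet> L y" using LIMSEQ_unique by auto
qed

lemma commutes_tendsto:
  assumes "Y \<longlonglongrightarrow> L" "\<And>n. commutes X (Y n)"
  shows "commutes X L"
proof (rule commutesI)
  fix x
  have "(\<lambda>n. X (Y n x)) \<longlonglongrightarrow> X (L x)" "(\<lambda>n. Y n (X x)) \<longlonglongrightarrow> L (X x)"
    by (intro tendsto_intros assms(1))+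
  moreover have "X (Y n x) = Y n (X x)" for n by (rule commutes_apply[OF assms(2)])
  ultimately show "X (L x) = L (X x)" using LIMSEQ_unique by auto
qed

text \<open>The Neumann series; the norm estimate sums the terms after the identity.\<close>

lemma neumann_inverse:
  fixes Y :: "'a::banach \<Rightarrow>\<^sub>L 'a"
  assumes "norm Y < 1"
  obtains V where "V o\<^sub>L (id_blinfun - Y) = id_blinfun" "(id_blinfun - Y) o\<^sub>L V = id_blinfun"
    "norm (V - id_blinfun) \<le> norm Y / (1 - norm Y)"
proof -
  define P where "P = rec_nat id_blinfun (\<lambda>_. (o\<^sub>L) Y)"
  have P0: "P 0 = id_blinfun" and PS: "P (Suc n) = Y o\<^sub>L P n" for n by (simp_all add: P_def)
  have PS': "P (Suc n) = P n o\<^sub>L Y" for n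
  proof (induction n)
    case 0 show ?case by (rule blinfun_eqI) (simp add: P0 PS)
  next
    case (Suc n)
    have "P (Suc (Suc n)) = Y o\<^sub>L (P n o\<^sub>L Y)" by (simp only: PS[of "Suc n"] Suc)
    also have "\<dots> = P (Suc n) o\<^sub>L Y" by (rule blinfun_eqI) (simp add: PS)
    finally show ?case .
  qed
  have nS: "norm (P n) \<le> norm Y ^ n" for n
  proof (induction n)
    case 0 show ?case by (simp add: P0 norm_blinfun_id_le)
  next
    case (Suc n)
    have "norm (P (Suc n)) \<le> norm Y * norm (P n)" unfolding PS by (rule norm_blinfun_compose)
    also have "\<dots> \<le> norm Y * norm Y ^ n" using Suc by (intro mult_left_mono) auto
    finally show ?case by simp
  qed
  have geo: "summable (\<lambda>n. norm Y ^ n)" using assms by (intro summable_geometric) simp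
  have sm: "summable P" by (rule summable_comparison_test'[OF geo]) (rule nS)
  define V where "V = suminf P"
  have split: "V = id_blinfun + (\<Sum>n. P (Suc n))"
    unfolding V_def using suminf_split_head[OF sm] by (simp add: P0)
  have "(\<Sum>n. Y o\<^sub>L P n) = Y o\<^sub>L V"
    unfolding V_def by (rule bounded_linear.suminf[OF bounded_bilinear.bounded_linear_right[OF
          bounded_bilinear_blinfun_compose] sm, symmetric])
  then have 1: "Y o\<^sub>L V = V - id_blinfun" using split by (simp add: PS)
  have "(\<Sum>n. P n o\<^sub>L Y) = V o\<^sub>L Y"
    unfolding V_def by (rule bounded_linear.suminf[OF bounded_bilinear.bounded_linear_left[OF
          bounded_bilinear_blinfun_compose] sm, symmetric])
  then have 2: "V o\<^sub>L Y = V - id_blinfun" using split by (simp add: PS')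
  have geoS: "summable (\<lambda>n. norm Y ^ Suc n)" using geo by (subst summable_Suc_iff)
  have "norm (\<Sum>n. P (Suc n)) \<le> (\<Sum>n. norm Y ^ Suc n)"
    by (rule norm_suminf_le[OF _ geoS]) (rule nS)
  also have "(\<Sum>n. norm Y ^ Suc n) = norm Y * (\<Sum>n. norm Y ^ n)"
    using geo by (simp add: suminf_mult)
  also have "\<dots> = norm Y / (1 - norm Y)" using assms by (simp add: suminf_geometric)
  finally have 3: "norm (V - id_blinfun) \<le> norm Y / (1 - norm Y)" using split by simp
  have "V o\<^sub>L (id_blinfun - Y) = V - (V o\<^sub>L Y)"
    by (rule blinfun_eqI) (simp add: blinfun.bilinear_simps)
  moreover have "(id_blinfun - Y) o\<^sub>L V = V - (Y o\<^sub>L V)"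
    by (rule blinfun_eqI) (simp add: blinfun.bilinear_simps)
  ultimately show ?thesis using that 1 2 3 by simp
qed

text \<open>
  The iteration \<open>Y \<mapsto> (A + Y\<^sup>2)/2\<close> is dominated, increments included, by the corresponding scalar
  iteration started at the norm of \<open>A\<close>, so it converges in operator norm.
\<close>

lemma sqrt_one_minus:
  fixes A :: "'a::{real_inner,banach} \<Rightarrow>\<^sub>L 'a"
  assumes "adj A = A" "norm A \<le> 1"
  obtains Y where "adj Y = Y" "norm Y \<le> norm A"
    "(id_blinfun - Y) o\<^sub>L (id_blinfun - Y) = id_blinfun - A"
    "\<And>X. commutes X A \<Longrightarrow> commutes X Y"
proof -
  define a where "a = norm A"
  define s where "s = rec_nat 0 (\<lambda>_ t. (a + t * t) / 2)"
  have s0: "s 0 = 0" and sS: "s (Suc n) = (a + s n * s n) / 2" for n by (simp_all add: s_def)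
  define Y where "Y = rec_nat 0 (\<lambda>_ Z. (1/2) *\<^sub>R (A + (Z o\<^sub>L Z)))"
  have Y0: "Y 0 = 0" and YS: "Y (Suc n) = (1/2) *\<^sub>R (A + (Y n o\<^sub>L Y n))" for n
    by (simp_all add: Y_def)
  have a: "0 \<le> a" "a \<le> 1" using assms(2) by (auto simp: a_def)
  have s: "0 \<le> s n \<and> s n \<le> a" for n
  proof (induction n)
    case (Suc n)
    have "s n * s n \<le> a * 1" using Suc a by (intro mult_mono) auto
    then show ?case using Suc a by (simp add: sS)
  qed (simp add: s0 a)
  have smono: "s n \<le> s (Suc n)" for n
  proof (induction n)
    case (Suc n)
    have "s n * s n \<le> s (Suc n) * s (Suc n)" using Suc s[of n] by (intro mult_mono) auto
    then show ?case by (simp only: sS[of "Suc n"] sS[of n]) (simp add: sS)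
  qed (simp add: s0 s)
  have nY: "norm (Y n) \<le> s n" for n
  proof (induction n)
    case (Suc n)
    have "norm (A + (Y n o\<^sub>L Y n)) \<le> a + norm (Y n) * norm (Y n)"
      unfolding a_def by (meson norm_triangle_le add_left_mono norm_blinfun_compose)
    also have "\<dots> \<le> a + s n * s n" using Suc s[of n] by (intro add_left_mono mult_mono) auto
    finally show ?case by (simp add: YS sS)
  qed (simp add: Y0 s0)
  have dY: "norm (Y (Suc n) - Y n) \<le> s (Suc n) - s n" for n
  proof (induction n)
    case 0 show ?case by (simp add: Y0 s0 YS sS a_def)
  next
    case (Suc n)
    let ?D = "Y (Suc n) - Y n"
    \<comment> \<open>A difference of two squares, factored without commutativity. The scalar
      iteration factors in the same way, which makes the two estimates match.\<close>
    have "Y (Suc (Suc n)) - Y (Suc n) = (1/2) *\<^sub>R ((Y (Suc n) o\<^sub>L ?D) + (?D o\<^sub>L Y n))"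
      by (subst arg_cong2[where f = minus, OF YS[of "Suc n"] YS[of n]], rule blinfun_eqI)
        (simp add: blinfun.bilinear_simps algebra_simps)
    also have "norm \<dots> \<le> (1/2) * (norm (Y (Suc n)) * norm ?D + norm ?D * norm (Y n))"
      using norm_triangle_le[OF add_mono[OF norm_blinfun_compose norm_blinfun_compose]] by simp
    also have "\<dots> \<le> (1/2) * (s (Suc n) * (s (Suc n) - s n) + (s (Suc n) - s n) * s n)"
      using Suc nY[of n] nY[of "Suc n"] s[of n] s[of "Suc n"] smono[of n]
      by (intro mult_left_mono add_mono mult_mono) auto
    also have "\<dots> = s (Suc (Suc n)) - s (Suc n)"
      by (subst (4) sS, subst (3) sS) (simp add: algebra_simps)
    finally show ?case .
  qed
  obtain l where l: "s \<longlonglongrightarrow> l"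
    using incseq_convergent[of s a] s smono by (metis incseq_SucI)
  have "summable (\<lambda>n. s (Suc n) - s n)" using telescope_summable[OF l] .
  then have "summable (\<lambda>n. Y (Suc n) - Y n)"
    by (rule summable_comparison_test') (rule dY)
  then have "convergent (\<lambda>n. \<Sum>k<n. Y (Suc k) - Y k)" by (simp add: summable_iff_convergent)
  then obtain L where L: "Y \<longlonglongrightarrow> L" by (auto simp: sum_lessThan_telescope Y0 convergent_def)
  have "(\<lambda>n. (1/2) *\<^sub>R (A + (Y n o\<^sub>L Y n))) \<longlonglongrightarrow> (1/2) *\<^sub>R (A + (L o\<^sub>L L))"
    by (intro tendsto_intros L bounded_bilinear.tendsto[OF bounded_bilinear_blinfun_compose])
  \<comment> \<open>Rearranged, this fixed point equation says that the square of
    \<open>id_blinfun - L\<close> is \<open>id_blinfun - A\<close>.\<close>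
  then have fixp: "L = (1/2) *\<^sub>R (A + (L o\<^sub>L L))"
    using LIMSEQ_Suc[OF L] LIMSEQ_unique by (auto simp: YS)
  have "adj (Y n) = Y n" for n
    by (induction n) (auto simp: Y0 YS adj_scaleR adj_add adj_compose assms(1) intro!: adj_unique)
  then have "adj L = L" using adj_tendsto[OF L] by blast
  moreover have "norm L \<le> norm A"
    using nY s unfolding a_def by (intro LIMSEQ_le_const2[OF tendsto_norm[OF L]]) (meson order_trans)
  moreover have "(id_blinfun - L) o\<^sub>L (id_blinfun - L) = id_blinfun - A"
  proof (rule blinfun_eqI)
    fix x
    have "L x = (1/2) *\<^sub>R (A x + L (L x))"
      by (subst fixp) (simp add: blinfun.bilinear_simps)
    then have "2 *\<^sub>R L x = A x + L (L x)" by (metis scaleR_half_double scaleR_left_commute scaleR_2 scaleR_add_right)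
    then show "((id_blinfun - L) o\<^sub>L (id_blinfun - L)) x = (id_blinfun - A) x"
      by (simp add: blinfun.bilinear_simps algebra_simps scaleR_2)
  qed
  moreover have "commutes X L" if "commutes X A" for X
  proof (rule commutes_tendsto[OF L])
    show "commutes X (Y n)" for n
      by (induction n) (auto simp: Y0 YS that intro!: commutes_scaleR commutes_add commutes_compose
          intro: commutesI)
  qed
  ultimately show ?thesis by (rule that)
qed

text \<open>Evaluating the nonnegative form at \<open>x - (1/c) H x\<close> and using the upper
  bound at \<open>H x\<close> bounds the squared norm of \<open>H x\<close> by \<open>c\<close>
  times the form at \<open>x\<close>; the upper bound at \<open>x\<close> finishes.\<close>

lemma norm_le_of_form_bounds:
  fixes H :: "'a::{real_inner,banach} \<Rightarrow>\<^sub>L 'a"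
  assumes "adj H = H" "0 < c" "\<And>x. 0 \<le> H x \<bullet> x" "\<And>x. H x \<bullet> x \<le> c * (x \<bullet> x)"
  shows "norm H \<le> c"
proof (rule norm_blinfun_bound)
  fix x
  have "H (H x) \<bullet> x = H x \<bullet> H x" using assms(1) by (simp add: adj)
  then have "H (x - (1/c) *\<^sub>R H x) \<bullet> (x - (1/c) *\<^sub>R H x)
      = H x \<bullet> x - (2/c) * (H x \<bullet> H x) + (1/c)\<^sup>2 * (H (H x) \<bullet> H x)"
    by (simp add: blinfun.bilinear_simps inner_simps power2_eq_square algebra_simps)
  moreover have "(1/c)\<^sup>2 * (H (H x) \<bullet> H x) \<le> (1/c)\<^sup>2 * (c * (H x \<bullet> H x))"
    using assms(4) by (intro mult_left_mono) auto
  moreover have "(1/c)\<^sup>2 * (c * (H x \<bullet> H x)) = (1/c) * (H x \<bullet> H x)"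
    using assms(2) by (simp add: power2_eq_square)
  ultimately have "(1/c) * (H x \<bullet> H x) \<le> H x \<bullet> x"
    using assms(3)[of "x - (1/c) *\<^sub>R H x"] by simp
  also have "\<dots> \<le> c * (x \<bullet> x)" by (rule assms(4))
  finally have "H x \<bullet> H x \<le> c * c * (x \<bullet> x)" using assms(2) by (simp add: field_simps)
  then have "(norm (H x))\<^sup>2 \<le> (c * norm x)\<^sup>2"
    by (simp add: power2_norm_eq_inner power_mult_distrib power2_eq_square[of c])
  then show "norm (H x) \<le> c * norm x" by (rule power2_le_imp_le) (use assms(2) in simp)
qed (use assms(2) in simp)

lemma inner_blinfun_le: "blinfun_apply H x \<bullet> x \<le> norm H * (x \<bullet> x)"
proof -
  have "H x \<bullet> x \<le> norm (H x) * norm x" by (rule norm_cauchy_schwarz)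
  also have "\<dots> \<le> (norm H * norm x) * norm x" by (intro mult_right_mono norm_blinfun) simp
  finally show ?thesis by (simp add: mult.assoc norm_times_norm)
qed

text \<open>After scaling, \<open>H\<close> differs from the identity by an operator whose form lies
  between 0 and \<open>1 - c/d\<close>, so the Neumann series inverts it.\<close>

lemma inverse_of_form_bounded_below:
  fixes H :: "'a::{real_inner,banach} \<Rightarrow>\<^sub>L 'a"
  assumes "adj H = H" "0 < c" "\<And>x. c * (x \<bullet> x) \<le> H x \<bullet> x"
  obtains V where "V o\<^sub>L H = id_blinfun" "H o\<^sub>L V = id_blinfun"
proof -
  \<comment> \<open>Being at least \<open>norm H\<close> keeps the form of \<open>Y\<close>
    nonnegative; being above \<open>c\<close> keeps the bound \<open>1 - c/d\<close>
    positive.\<close>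
  define d where "d = norm H + c + 1"
  have d: "0 < d" "c < d" "norm H \<le> d" using assms(2) by (auto simp: d_def add_nonneg_pos)
  define Y where "Y = id_blinfun - (1/d) *\<^sub>R H"
  have Yx: "Y x \<bullet> x = x \<bullet> x - (H x \<bullet> x) / d" for x
    by (simp add: Y_def blinfun.bilinear_simps inner_simps)
  have "norm Y \<le> 1 - c/d"
  proof (rule norm_le_of_form_bounds)
    show "adj Y = Y" by (simp add: Y_def adj_diff adj_scaleR assms(1))
    show "0 < 1 - c/d" using d by simp
    show "0 \<le> Y x \<bullet> x" for x
    proof -
      have "H x \<bullet> x \<le> d * (x \<bullet> x)"
        using inner_blinfun_le[of H x] d(3) by (meson inner_ge_zero mult_right_mono order_trans)
      then show ?thesis using d by (simp add: Yx field_simps)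
    qed
    show "Y x \<bullet> x \<le> (1 - c/d) * (x \<bullet> x)" for x
      using assms(3)[of x] d by (simp add: Yx field_simps)
  qed
  moreover have "c/d > 0" using d assms(2) by simp
  ultimately have "norm Y < 1" by linarith
  then obtain V where V: "V o\<^sub>L (id_blinfun - Y) = id_blinfun" "(id_blinfun - Y) o\<^sub>L V = id_blinfun"
    by (rule neumann_inverse)
  have iY: "id_blinfun - Y = (1/d) *\<^sub>R H" by (simp add: Y_def)
  have "((1/d) *\<^sub>R V) o\<^sub>L H = id_blinfun" "H o\<^sub>L ((1/d) *\<^sub>R V) = id_blinfun"
    using V unfolding iY
    by (simp_all add: bounded_bilinear.scaleR_left[OF bounded_bilinear_blinfun_compose]
        bounded_bilinear.scaleR_right[OF bounded_bilinear_blinfun_compose])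
  then show ?thesis by (rule that)
qed

text \<open>Invariance of \<open>M\<close> under the adjoint makes \<open>X\<close> preserve the
  orthogonal complement as well.\<close>

lemma commutes_proj:
  fixes M :: "'a::{real_inner,banach} set"
  assumes "subspace M" "closed M" "\<And>x. x \<in> M \<Longrightarrow> blinfun_apply X x \<in> M"
    "\<And>x. x \<in> M \<Longrightarrow> adj X x \<in> M"
  shows "commutes X (proj M)"
proof (rule commutesI)
  fix x
  show "X (proj M x) = proj M (X x)"
  proof (rule proj_unique[OF assms(1,2), symmetric])
    show "X (proj M x) \<in> M" using assms proj_props(1) by blast
    fix y assume "y \<in> M"
    then have "(x - proj M x) \<bullet> adj X y = 0" using proj_props(2)[OF assms(1,2)] assms(4) by blast
    then show "(X x - X (proj M x)) \<bullet> y = 0" by (simp add: blinfun.diff_right flip: adj)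
  qed
qed

text \<open>\<open>p\<close> projects onto the kernel of \<open>|B| + B\<close>, the spectral
  subspace for the nonpositive half-line. There \<open>B = - |B|\<close>. On the complement
  \<open>B = |B|\<close>, because \<open>|B| + B\<close> annihilates the range of
  \<open>|B| - B\<close>.\<close>

lemma spectral_projection:
  fixes B :: "'a::{real_inner,banach} \<Rightarrow>\<^sub>L 'a"
  assumes B: "adj B = B"
  obtains p where "adj p = p" "p o\<^sub>L p = p" "\<And>X. commutes X B \<Longrightarrow> commutes X p"
    "\<And>x. p x = x \<Longrightarrow> B x \<bullet> x \<le> 0" "\<And>x. p x = 0 \<Longrightarrow> 0 \<le> B x \<bullet> x"
proof -
  \<comment> \<open>Scaling brings the square of \<open>B1\<close> into the range of
    \<open>sqrt_one_minus\<close>, which then yields \<open>C\<close> as the modulus of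
    \<open>B1\<close>.\<close>
  define b where "b = norm B + 1"
  have b: "b > 0" by (simp add: b_def add_nonneg_pos)
  define B1 where "B1 = (1/b) *\<^sub>R B"
  have B1: "adj B1 = B1" by (simp add: B1_def adj_scaleR B)
  have "norm B1 \<le> 1" using b by (simp add: B1_def) (simp add: b_def)
  define A where "A = id_blinfun - (B1 o\<^sub>L B1)"
  have A: "adj A = A" by (simp add: A_def adj_diff adj_compose B1)
  have Ax: "A x \<bullet> x = x \<bullet> x - B1 x \<bullet> B1 x" for x
    using adj[of B1 "B1 x" x] by (simp add: A_def blinfun.bilinear_simps inner_simps B1)
  have "norm A \<le> 1"
  proof (rule norm_le_of_form_bounds[OF A])
    show "0 \<le> A x \<bullet> x" for x
    proof -
      have "norm (B1 x) \<le> 1 * norm x"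
        using norm_blinfun[of B1 x] \<open>norm B1 \<le> 1\<close> by (meson mult_right_mono norm_ge_zero order_trans)
      then show ?thesis unfolding Ax by (simp add: norm_le)
    qed
    show "A x \<bullet> x \<le> 1 * (x \<bullet> x)" for x by (simp add: Ax)
  qed simp
  then obtain Y where Y: "adj Y = Y" "norm Y \<le> norm A"
    "(id_blinfun - Y) o\<^sub>L (id_blinfun - Y) = id_blinfun - A"
    "\<And>X. commutes X A \<Longrightarrow> commutes X Y"
    using sqrt_one_minus[OF A] by blast
  define C where "C = id_blinfun - Y"
  have adjC: "adj C = C" by (simp add: C_def adj_diff Y)
  have CC: "C (C x) = B1 (B1 x)" for x
    using arg_cong[OF Y(3), of "\<lambda>f. blinfun_apply f x"]
    by (simp add: C_def A_def blinfun.bilinear_simps)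
  have Cpos: "0 \<le> C x \<bullet> x" for x
  proof -
    have "Y x \<bullet> x \<le> norm Y * (x \<bullet> x)" by (rule inner_blinfun_le)
    also have "\<dots> \<le> 1 * (x \<bullet> x)"
      using Y(2) \<open>norm A \<le> 1\<close> by (intro mult_right_mono) auto
    finally show ?thesis by (simp add: C_def blinfun.bilinear_simps inner_simps)
  qed
  have comm: "commutes X B1" "commutes X C" if "commutes X B" for X
  proof -
    show "commutes X B1" using that by (simp add: B1_def commutes_scaleR)
    then have "commutes X A" by (simp add: A_def commutes_diff commutes_compose)
    then show "commutes X C" by (simp add: C_def commutes_diff Y)
  qed
  have CB: "C (B1 x) = B1 (C x)" for x
    using comm(2)[OF commutes_refl] commutes_scaleR commutes_apply
    by (metis B1_def commutes_sym)
  define E where "E = {x. C x + B1 x = 0}"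
  have E: "subspace E" "closed E"
    by (auto simp: E_def subspace_def blinfun.bilinear_simps algebra_simps
        intro!: closed_Collect_eq continuous_intros simp flip: scaleR_add_right)
  show ?thesis
  proof (rule that[of "proj E"])
    show "adj (proj E) = proj E" using adj_proj[OF E] .
    show "proj E o\<^sub>L proj E = proj E"
      by (rule blinfun_eqI) (simp add: proj_ident[OF E] proj_props[OF E])
    show "commutes X (proj E)" if X: "commutes X B" for X
    proof (rule commutes_proj[OF E])
      have inv: "Z x \<in> E" if "commutes Z B" "x \<in> E" for Z x
      proof -
        have "C (Z x) + B1 (Z x) = Z (C x + B1 x)"
          by (simp add: blinfun.add_right commutes_apply[OF comm(1)[OF that(1)]]
              commutes_apply[OF comm(2)[OF that(1)]])
        then show ?thesis using that(2) by (simp add: E_def)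
      qed
      show "X x \<in> E" if "x \<in> E" for x using inv[OF X that] .
      show "adj X x \<in> E" if "x \<in> E" for x
        using inv[OF _ that, of "adj X"] commutes_adj[OF X] B by simp
    qed
    show "B x \<bullet> x \<le> 0" if "proj E x = x" for x
    proof -
      have "x \<in> E" using that proj_props(1)[OF E] by metis
      then have "C x = - B1 x" by (simp add: E_def eq_neg_iff_add_eq_0)
      then have "B1 x \<bullet> x \<le> 0" using Cpos[of x] by simp
      then show ?thesis using b by (simp add: B1_def blinfun.bilinear_simps divide_le_0_iff)
    qed
    show "0 \<le> B x \<bullet> x" if "proj E x = 0" for x
    proof -
      have "(C x - B1 x) \<bullet> z = 0" for z
      proof -
        \<comment> \<open>The product of \<open>C + B1\<close> and \<open>C - B1\<close> vanishes,
          since the two operators commute and have equal squares.\<close>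
        have "C z - B1 z \<in> E" by (simp add: E_def blinfun.bilinear_simps CC CB)
        then have "x \<bullet> (C z - B1 z) = 0" using proj_props(2)[OF E, of "C z - B1 z" x] that by simp
        moreover have "x \<bullet> C z = C x \<bullet> z" "x \<bullet> B1 z = B1 x \<bullet> z"
          by (simp_all add: adj adjC B1)
        ultimately show ?thesis by (simp add: inner_simps)
      qed
      then have "C x - B1 x = 0" using inner_eq_zero_iff by blast
      then have "0 \<le> B1 x \<bullet> x" using Cpos[of x] by simp
      then show ?thesis using b by (simp add: B1_def blinfun.bilinear_simps zero_le_divide_iff)
    qed
  qed
qed

section \<open>Approximation by operators whose modulus has finite spectrum\<close>

text \<open>For a self-adjoint operator this amounts to finite spectrum. The span is algebraic,
  without closure, so every vector is a finite sum of eigenvectors.\<close>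

definition fin_spec :: "('a::real_normed_vector \<Rightarrow>\<^sub>L 'a) \<Rightarrow> bool" where
  "fin_spec R \<longleftrightarrow> (\<exists>A. finite A \<and> span {v. \<exists>a\<in>A. R v = a *\<^sub>R v} = UNIV)"

text \<open>As the eigenvectors of \<open>D\<close> span, it is enough to decompose each of them
  into eigenvectors of \<open>R\<close>; \<open>f\<close> produces the new eigenvalue list from the
  old one.\<close>

lemma fin_specI:
  fixes R D :: "'a::real_normed_vector \<Rightarrow>\<^sub>L 'a"
  assumes "fin_spec D" "\<And>A. finite A \<Longrightarrow> finite (f A)"
    "\<And>A v a. a \<in> A \<Longrightarrow> D v = a *\<^sub>R v \<Longrightarrow> v \<in> span {v. \<exists>a\<in>f A. R v = a *\<^sub>R v}"
  shows "fin_spec R"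
proof -
  obtain A where A: "finite A" "span {v. \<exists>a\<in>A. D v = a *\<^sub>R v} = UNIV"
    using assms(1) by (auto simp: fin_spec_def)
  have "{v. \<exists>a\<in>A. D v = a *\<^sub>R v} \<subseteq> span {v. \<exists>a\<in>f A. R v = a *\<^sub>R v}"
    using assms(3) by blast
  then have "span {v. \<exists>a\<in>f A. R v = a *\<^sub>R v} = UNIV"
    using A(2) span_minimal[OF _ subspace_span] by blast
  then show ?thesis using assms(2)[OF A(1)] by (auto simp: fin_spec_def)
qed

lemma fin_spec_zero: "fin_spec 0"
  unfolding fin_spec_def by (rule exI[of _ "{0}"]) simp

lemma fin_spec_square:
  assumes "fin_spec D" shows "fin_spec (D o\<^sub>L D)"
  by (rule fin_specI[OF assms, where f = "image (\<lambda>a. a * a)"])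
    (auto intro!: span_base simp: blinfun.bilinear_simps)

text \<open>An eigenvector \<open>v\<close> of \<open>D\<close> splits into \<open>v - p v\<close>
  and \<open>p v\<close>, again eigenvectors of \<open>D\<close>; the eigenvalue \<open>a\<close> is
  kept on the first part and becomes \<open>a + c\<close> on the second.\<close>

lemma fin_spec_add_projection:
  assumes D: "fin_spec D" and p: "p o\<^sub>L p = p" "commutes p D"
  shows "fin_spec (D + c *\<^sub>R p)"
proof (rule fin_specI[OF D, where f = "\<lambda>A. A \<union> (\<lambda>a. a + c) ` A"])
  fix A v and a :: real
  assume a: "a \<in> A" "D v = a *\<^sub>R v"
  let ?E = "{v. \<exists>a\<in>A \<union> (\<lambda>a. a + c) ` A. (D + c *\<^sub>R p) v = a *\<^sub>R v}"
  have pp: "p (p x) = p x" for x using p(1) by (metis blinfun_apply_blinfun_compose)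
  have pD: "D (p v) = a *\<^sub>R p v"
    using commutes_apply[OF p(2), of v] a(2) by (simp add: blinfun.bilinear_simps)
  have "v - p v \<in> ?E" using a pp pD
    by (auto simp: blinfun.bilinear_simps algebra_simps intro!: bexI[of _ a])
  moreover have "p v \<in> ?E" using a pp pD
    by (auto simp: blinfun.bilinear_simps algebra_simps intro!: bexI[of _ "a + c"])
  ultimately have "(v - p v) + p v \<in> span ?E" by (intro span_add span_base)
  then show "v \<in> span ?E" by simp
qed simp

lemma fin_spec_compose_projection:
  assumes D: "fin_spec D" and p: "p o\<^sub>L p = p" "commutes p D"
  shows "fin_spec (D o\<^sub>L p)"
proof (rule fin_specI[OF D, where f = "insert 0"])
  fix A v and a :: real
  assume a: "a \<in> A" "D v = a *\<^sub>R v"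
  let ?E = "{v. \<exists>a\<in>insert 0 A. (D o\<^sub>L p) v = a *\<^sub>R v}"
  have pp: "p (p x) = p x" for x using p(1) by (metis blinfun_apply_blinfun_compose)
  have pD: "D (p v) = a *\<^sub>R p v"
    using commutes_apply[OF p(2), of v] a(2) by (simp add: blinfun.bilinear_simps)
  have "v - p v \<in> ?E" using pp by (simp add: blinfun.bilinear_simps)
  moreover have "p v \<in> ?E" using a pp pD by auto
  ultimately have "(v - p v) + p v \<in> span ?E" by (intro span_add span_base)
  then show "v \<in> span ?E" by simp
qed simp

text \<open>A splitting of the space into two orthogonal pieces. Operators commuting with
  \<open>p\<close> are block diagonal, so their forms can be estimated on each piece
  separately.\<close>

locale orth_projection =
  fixes p r :: "'a::{real_inner,banach} \<Rightarrow>\<^sub>L 'a"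
  assumes adj_p: "adj p = p" and p_idem: "p o\<^sub>L p = p" and r_def: "r = id_blinfun - p"
begin

lemma pp: "p (p x) = p x"
  using p_idem by (metis blinfun_apply_blinfun_compose)

lemma r_apply: "r x = x - p x" and pr: "p (r x) = 0" and rp: "r (p x) = 0"
  and rr: "r (r x) = r x"
  by (simp_all add: r_def blinfun.bilinear_simps pp)

lemma adj_r: "adj r = r" and r_idem: "r o\<^sub>L r = r"
  by (auto simp: r_def adj_diff adj_p blinfun.bilinear_simps pp intro!: blinfun_eqI)

lemma inner_r: "r x \<bullet> y = x \<bullet> r y" and inner_p: "p x \<bullet> y = x \<bullet> p y"
  by (simp_all add: adj adj_r adj_p)

lemma norm_split: "x \<bullet> x = p x \<bullet> p x + r x \<bullet> r x"
  by (simp add: r_apply inner_simps inner_p pp)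

lemma form_r: "commutes r H \<Longrightarrow> H (r x) \<bullet> x = H (r x) \<bullet> r x"
  using inner_r[of "H (r x)" x] by (simp add: commutes_apply[of r H] rr)

lemma form_p: "commutes p H \<Longrightarrow> H (p x) \<bullet> x = H (p x) \<bullet> p x"
  using inner_p[of "H (p x)" x] by (simp add: commutes_apply[of p H] pp)

lemma commutes_r: "commutes X p \<Longrightarrow> commutes X r"
  by (simp add: r_def commutes_diff)

lemma form_split: "commutes p H \<Longrightarrow> H x \<bullet> x = H (p x) \<bullet> p x + H (r x) \<bullet> r x"
  using form_p[of H x] form_r[of H x] commutes_r[of H]
  by (simp add: commutes_sym r_apply blinfun.bilinear_simps inner_simps)

end

text \<open>Induction on the number of bisections. Cutting \<open>[0, 2 ^ Suc n * e]\<close> at its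
  midpoint \<open>c\<close> by a spectral projection and subtracting \<open>c\<close> on the upper
  piece brings the form into the lower half; adding \<open>c\<close> back on that piece restores it.
  Thus \<open>G\<close> is rounded down one binary digit at a time, with an error at most
  \<open>e\<close>.\<close>

lemma finite_rounding:
  fixes G :: "'a::{real_inner,banach} \<Rightarrow>\<^sub>L 'a"
  assumes "e > 0"
  shows "adj G = G \<Longrightarrow> (\<And>x. 0 \<le> G x \<bullet> x) \<Longrightarrow> (\<And>x. G x \<bullet> x \<le> 2 ^ n * e * (x \<bullet> x)) \<Longrightarrow>
    \<exists>D. adj D = D \<and> fin_spec D \<and> (\<forall>X. commutes X G \<longrightarrow> commutes X D) \<and> (\<forall>x. 0 \<le> D x \<bullet> x) \<and>
      (\<forall>x. 0 \<le> (G - D) x \<bullet> x \<and> (G - D) x \<bullet> x \<le> e * (x \<bullet> x))"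
proof (induction n arbitrary: G)
  case 0
  then show ?case
    by (intro exI[of _ 0]) (auto simp: fin_spec_zero blinfun.bilinear_simps intro: adj_unique commutesI)
next
  case (Suc n)
  define c where "c = 2 ^ n * e"
  have c: "c > 0" using assms by (simp add: c_def)
  define B where "B = G - c *\<^sub>R id_blinfun"
  have "adj B = B" by (simp add: B_def adj_diff adj_scaleR Suc.prems)
  then obtain p where p: "adj p = p" "p o\<^sub>L p = p" "\<And>X. commutes X B \<Longrightarrow> commutes X p"
    "\<And>x. p x = x \<Longrightarrow> B x \<bullet> x \<le> 0" "\<And>x. p x = 0 \<Longrightarrow> 0 \<le> B x \<bullet> x"
    by (rule spectral_projection) blast
  define r where "r = id_blinfun - p"
  interpret orth_projection p r by unfold_locales (use p r_def in auto)
  have Xp: "commutes X p" if "commutes X G" for X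
    using that by (intro p(3)) (simp add: B_def commutes_diff commutes_scaleR)
  have pG: "commutes p G" using Xp[OF commutes_refl] commutes_sym by blast
  define G1 where "G1 = G - c *\<^sub>R r"
  have G1x: "G1 x \<bullet> x = G (p x) \<bullet> p x + (G (r x) \<bullet> r x - c * (r x \<bullet> r x))" for x
  proof -
    have "r x \<bullet> x = r x \<bullet> r x" by (metis inner_r rr)
    then show ?thesis by (simp add: G1_def blinfun.bilinear_simps inner_simps form_split[OF pG, of x])
  qed
  have b1: "G (p x) \<bullet> p x \<le> c * (p x \<bullet> p x)" for x
    using p(4)[OF pp] by (simp add: B_def blinfun.bilinear_simps inner_simps)
  have b2: "c * (r x \<bullet> r x) \<le> G (r x) \<bullet> r x" for x
    using p(5)[OF pr] by (simp add: B_def blinfun.bilinear_simps inner_simps)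
  have b3: "G (r x) \<bullet> r x \<le> 2 * c * (r x \<bullet> r x)" for x
    using Suc.prems(3)[of "r x"] by (simp add: c_def)
  have "\<exists>D. adj D = D \<and> fin_spec D \<and> (\<forall>X. commutes X G1 \<longrightarrow> commutes X D) \<and> (\<forall>x. 0 \<le> D x \<bullet> x) \<and>
      (\<forall>x. 0 \<le> (G1 - D) x \<bullet> x \<and> (G1 - D) x \<bullet> x \<le> e * (x \<bullet> x))"
  proof (rule Suc.IH)
    show "adj G1 = G1" by (simp add: G1_def adj_diff adj_scaleR adj_r Suc.prems)
    show "0 \<le> G1 x \<bullet> x" for x
      using Suc.prems(2)[of "p x"] b2[of x] by (simp add: G1x)
    have "G1 x \<bullet> x \<le> c * (x \<bullet> x)" for x
      using b1[of x] b3[of x] unfolding G1x norm_split[of x] by (simp add: algebra_simps)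
    then show "G1 x \<bullet> x \<le> 2 ^ n * e * (x \<bullet> x)" for x by (simp add: c_def)
  qed
  then obtain D1 where D1: "adj D1 = D1" "fin_spec D1" "\<And>X. commutes X G1 \<Longrightarrow> commutes X D1"
    "\<And>x. 0 \<le> D1 x \<bullet> x" "\<And>x. 0 \<le> (G1 - D1) x \<bullet> x \<and> (G1 - D1) x \<bullet> x \<le> e * (x \<bullet> x)" by blast
  have XG1: "commutes X G1" if "commutes X G" for X
    using that by (simp add: G1_def commutes_diff commutes_scaleR commutes_r Xp)
  have rG: "commutes r G" using commutes_r[of G] pG commutes_sym by blast
  have diff: "G - (D1 + c *\<^sub>R r) = G1 - D1" by (simp add: G1_def)
  have "adj (D1 + c *\<^sub>R r) = D1 + c *\<^sub>R r" by (simp add: adj_add adj_scaleR adj_r D1)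
  moreover have "fin_spec (D1 + c *\<^sub>R r)"
    by (rule fin_spec_add_projection[OF D1(2) r_idem D1(3)[OF XG1[OF rG]]])
  moreover have "commutes X (D1 + c *\<^sub>R r)" if "commutes X G" for X
    using that by (simp add: commutes_add commutes_scaleR commutes_r Xp D1 XG1)
  moreover have "0 \<le> (D1 + c *\<^sub>R r) x \<bullet> x" for x
  proof -
    have "r x \<bullet> x = r x \<bullet> r x" by (metis inner_r rr)
    then show ?thesis using D1(4)[of x] c by (simp add: blinfun.bilinear_simps inner_simps)
  qed
  ultimately show ?case using D1(5) unfolding diff[symmetric] by blast
qed

text \<open>\<open>G\<close> is the positive square root of \<open>adj T o\<^sub>L T\<close>,
  obtained from \<open>sqrt_one_minus\<close> after scaling this operator below the
  identity.\<close>

lemma modulus_exists: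
  fixes T :: "'a::{real_inner,banach} \<Rightarrow>\<^sub>L 'a"
  obtains G where "adj G = G" "G o\<^sub>L G = adj T o\<^sub>L T" "\<And>x. 0 \<le> G x \<bullet> x"
    "\<And>X. commutes X (adj T o\<^sub>L T) \<Longrightarrow> commutes X G"
proof -
  define b where "b = norm T + 1"
  have b: "b > 0" by (simp add: b_def add_nonneg_pos)
  define R where "R = (1/b\<^sup>2) *\<^sub>R (adj T o\<^sub>L T)"
  have adjR: "adj R = R" by (simp add: R_def adj_scaleR adj_compose)
  have Rx: "R x \<bullet> x = (1/b\<^sup>2) * (T x \<bullet> T x)" for x
    using adj[of T x "T x"] by (simp add: R_def blinfun.bilinear_simps inner_commute)
  have Rle: "R x \<bullet> x \<le> x \<bullet> x" for x
  proof -
    have "norm (T x) \<le> b * norm x"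
      using norm_blinfun[of T x] norm_ge_zero[of x] unfolding b_def distrib_right by linarith
    then have "(norm (T x))\<^sup>2 \<le> (b * norm x)\<^sup>2" by (intro power_mono) auto
    then have "T x \<bullet> T x \<le> b\<^sup>2 * (x \<bullet> x)" by (simp add: power_mult_distrib power2_norm_eq_inner)
    then show ?thesis using b by (simp add: Rx divide_le_eq mult.commute)
  qed
  have "norm (id_blinfun - R) \<le> 1"
    using Rle by (intro norm_le_of_form_bounds)
      (auto simp: adj_diff adjR blinfun.bilinear_simps inner_simps Rx)
  moreover have "adj (id_blinfun - R) = id_blinfun - R" by (simp add: adj_diff adjR)
  ultimately obtain Y where Y: "adj Y = Y" "norm Y \<le> norm (id_blinfun - R)"
    "(id_blinfun - Y) o\<^sub>L (id_blinfun - Y) = id_blinfun - (id_blinfun - R)"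
    "\<And>X. commutes X (id_blinfun - R) \<Longrightarrow> commutes X Y"
    using sqrt_one_minus by blast
  define G where "G = b *\<^sub>R (id_blinfun - Y)"
  show ?thesis
  proof (rule that)
    show "adj G = G" by (simp add: G_def adj_scaleR adj_diff Y)
    have "G o\<^sub>L G = b\<^sup>2 *\<^sub>R ((id_blinfun - Y) o\<^sub>L (id_blinfun - Y))"
      by (rule blinfun_eqI) (simp add: G_def blinfun.bilinear_simps power2_eq_square algebra_simps)
    also have "\<dots> = adj T o\<^sub>L T" using b unfolding Y(3) by (simp add: R_def)
    finally show "G o\<^sub>L G = adj T o\<^sub>L T" .
    show "0 \<le> G x \<bullet> x" for x
    proof -
      have "Y x \<bullet> x \<le> norm Y * (x \<bullet> x)" by (rule inner_blinfun_le)
      also have "\<dots> \<le> 1 * (x \<bullet> x)"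
        using Y(2) \<open>norm (id_blinfun - R) \<le> 1\<close> by (intro mult_right_mono) auto
      finally show ?thesis using b by (simp add: G_def blinfun.bilinear_simps inner_simps)
    qed
    show "commutes X G" if "commutes X (adj T o\<^sub>L T)" for X
      using that by (simp add: G_def R_def commutes_scaleR commutes_diff Y)
  qed
qed

text \<open>In the polar decomposition \<open>T = V G\<close>, the part of \<open>G\<close> below
  the cutoff \<open>h\<close> is replaced by 0 and the rest is rounded to finitely many values, all
  at least \<open>h\<close>. The gap above 0 provides the generalized inverse
  \<open>S'\<close>.\<close>

lemma finite_modulus_approximation:
  fixes T :: "'a::{real_inner,banach} \<Rightarrow>\<^sub>L 'a"
  assumes "e > 0"
  obtains S S' where "norm (T - S) \<le> e" "fin_spec (adj S o\<^sub>L S)" "S o\<^sub>L S' o\<^sub>L S = S"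
    "\<And>X. commutes X T \<Longrightarrow> commutes X (adj T) \<Longrightarrow> commutes X S \<and> commutes X S'"
proof -
  \<comment> \<open>Cutting off and rounding cost at most \<open>h\<close> each. The bound by 1 lets
    the summand \<open>p\<close> in \<open>H\<close> and in \<open>D + p\<close> dominate
    \<open>h\<close> on the range of \<open>p\<close>.\<close>
  define h where "h = min (e/2) 1"
  have h: "h > 0" "h \<le> 1" "2 * h \<le> e" using assms by (auto simp: h_def)
  obtain G where G: "adj G = G" "G o\<^sub>L G = adj T o\<^sub>L T" "\<And>x. 0 \<le> G x \<bullet> x"
    "\<And>X. commutes X (adj T o\<^sub>L T) \<Longrightarrow> commutes X G" using modulus_exists[of T] by blast
  have TG: "T x \<bullet> T y = G x \<bullet> G y" for x y
  proof -
    have "T x \<bullet> T y = x \<bullet> (adj T o\<^sub>L T) y" by (simp add: adj)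
    also have "\<dots> = x \<bullet> G (G y)" by (simp flip: G(2))
    finally show ?thesis using adj[of G x "G y"] by (simp add: G(1))
  qed
  define B where "B = G - h *\<^sub>R id_blinfun"
  have "adj B = B" by (simp add: B_def adj_diff adj_scaleR G)
  then obtain p where p: "adj p = p" "p o\<^sub>L p = p" "\<And>X. commutes X B \<Longrightarrow> commutes X p"
    "\<And>x. p x = x \<Longrightarrow> B x \<bullet> x \<le> 0" "\<And>x. p x = 0 \<Longrightarrow> 0 \<le> B x \<bullet> x"
    by (rule spectral_projection) blast
  define r where "r = id_blinfun - p"
  interpret orth_projection p r by unfold_locales (use p r_def in auto)
  have Xp: "commutes X p" if "commutes X G" for X
    using that by (intro p(3)) (simp add: B_def commutes_diff commutes_scaleR)
  have Xr: "commutes X r" if "commutes X G" for X using commutes_r Xp that by blast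
  have pG: "commutes p G" and rG: "commutes r G"
    using Xp[OF commutes_refl] Xr[OF commutes_refl] commutes_sym by blast+
  have b1: "G (p x) \<bullet> p x \<le> h * (p x \<bullet> p x)" for x
    using p(4)[OF pp] by (simp add: B_def blinfun.bilinear_simps inner_simps)
  have b2: "h * (r x \<bullet> r x) \<le> G (r x) \<bullet> r x" for x
    using p(5)[OF pr] by (simp add: B_def blinfun.bilinear_simps inner_simps)
  have pxx: "p x \<bullet> x = p x \<bullet> p x" for x by (metis inner_p pp)
  have hle: "h * (x \<bullet> x) \<le> u + p x \<bullet> p x" if "h * (r x \<bullet> r x) \<le> u" for x u
  proof -
    have "h * (p x \<bullet> p x) \<le> 1 * (p x \<bullet> p x)" using h by (intro mult_right_mono) auto
    then show ?thesis using that by (simp add: norm_split[of x] algebra_simps)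
  qed
  \<comment> \<open>\<open>G\<close> itself may fail to be invertible; putting the identity on the
    range of \<open>p\<close> makes it bounded below by \<open>h\<close>, while nothing changes on
    the range of \<open>r\<close>.\<close>
  define H where "H = (G o\<^sub>L r) + p"
  have adjGr: "adj (G o\<^sub>L r) = G o\<^sub>L r"
    using rG by (simp add: adj_compose adj_r G commutes_def)
  have XH: "commutes X H" if "commutes X G" for X
    using that by (simp add: H_def commutes_add commutes_compose Xr Xp)
  obtain Z where Z: "Z o\<^sub>L H = id_blinfun" "H o\<^sub>L Z = id_blinfun"
  proof (rule inverse_of_form_bounded_below)
    show "adj H = H" by (simp add: H_def adj_add adjGr adj_p)
    show "h * (x \<bullet> x) \<le> H x \<bullet> x" for x
      using hle[OF b2] by (simp add: H_def blinfun.bilinear_simps inner_simps form_r[OF rG] pxx)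
  qed (use h in auto)
  have ZH: "Z (H x) = x" and HZ: "H (Z x) = x" for x
    using Z by (metis blinfun_apply_blinfun_compose blinfun_apply_id_blinfun id_apply)+
  have XZ: "commutes X Z" if "commutes X G" for X
    using commutes_inverse[OF XH[OF that] Z] .
  have Gr: "G (r x) = H (r x)" for x by (simp add: H_def blinfun.bilinear_simps rr pr)
  have Zr: "Z (r x) = r (Z x)" for x using commutes_apply[OF XZ[OF rG]] by simp
  have Hr: "H (r x) = r (H x)" for x using commutes_apply[OF XH[OF rG]] by simp
  have GZr: "G (Z (r x)) = r x" for x by (simp add: Zr Gr) (simp add: Hr HZ)
  \<comment> \<open>Dividing \<open>T\<close> by its modulus on the range of \<open>r\<close> gives
    a partial isometry with initial projection \<open>r\<close>.\<close>
  define V where "V = T o\<^sub>L Z o\<^sub>L r"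
  have VV: "V x \<bullet> V y = r x \<bullet> r y" for x y by (simp add: V_def TG GZr)
  have adjVV: "adj V (V x) = r x" for x
    by (subst vector_eq_ldot[symmetric]) (simp add: VV inner_r rr flip: adj)
  have VG: "V (G x) = T (r x)" for x
    using commutes_apply[OF rG, of x] by (simp add: V_def Gr ZH)
  \<comment> \<open>Only the excess over \<open>h\<close> is rounded. Adding \<open>h\<close> back
    in \<open>D\<close> then keeps \<open>D\<close> at least \<open>h\<close> on the range of
    \<open>r\<close>.\<close>
  define G1 where "G1 = (G - h *\<^sub>R id_blinfun) o\<^sub>L r"
  have rGh: "commutes r (G - h *\<^sub>R id_blinfun)" by (simp add: commutes_diff commutes_scaleR rG)
  have G1x: "G1 x \<bullet> x = G (r x) \<bullet> r x - h * (r x \<bullet> r x)" for x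
    using form_r[OF rGh, of x] by (simp add: G1_def blinfun.bilinear_simps inner_simps)
  have adjG1: "adj G1 = G1"
    using rGh by (simp add: G1_def adj_compose adj_r adj_diff adj_scaleR G commutes_def)
  obtain n where n: "norm G / h < 2 ^ n" using real_arch_pow[of 2 "norm G / h"] by auto
  have "\<exists>D. adj D = D \<and> fin_spec D \<and> (\<forall>X. commutes X G1 \<longrightarrow> commutes X D) \<and> (\<forall>x. 0 \<le> D x \<bullet> x) \<and>
      (\<forall>x. 0 \<le> (G1 - D) x \<bullet> x \<and> (G1 - D) x \<bullet> x \<le> h * (x \<bullet> x))"
  proof (rule finite_rounding[OF h(1)])
    show "adj G1 = G1" by (rule adjG1)
    show "0 \<le> G1 x \<bullet> x" for x using b2[of x] by (simp add: G1x)
    show "G1 x \<bullet> x \<le> 2 ^ n * h * (x \<bullet> x)" for x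
    proof -
      have "G1 x \<bullet> x \<le> G (r x) \<bullet> r x" using h by (simp add: G1x)
      also have "\<dots> \<le> norm G * (r x \<bullet> r x)" by (rule inner_blinfun_le)
      also have "\<dots> \<le> (2 ^ n * h) * (x \<bullet> x)"
        using n h norm_split[of x] by (intro mult_mono) (auto simp: field_simps)
      finally show ?thesis .
    qed
  qed
  then obtain E where E: "adj E = E" "fin_spec E" "\<And>X. commutes X G1 \<Longrightarrow> commutes X E"
    "\<And>x. 0 \<le> E x \<bullet> x" "\<And>x. 0 \<le> (G1 - E) x \<bullet> x \<and> (G1 - E) x \<bullet> x \<le> h * (x \<bullet> x)" by blast
  have XG1: "commutes X G1" if "commutes X G" for X
    using that by (simp add: G1_def commutes_diff commutes_scaleR commutes_compose Xr)
  have XE: "commutes X E" if "commutes X G" for X using E(3) XG1 that by blast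
  define D where "D = (E + h *\<^sub>R id_blinfun) o\<^sub>L r"
  have rE: "commutes r E" using XE[OF rG] .
  have XD: "commutes X D" if "commutes X G" for X
    using that by (simp add: D_def commutes_compose commutes_add commutes_scaleR XE Xr)
  have fD: "fin_spec D" unfolding D_def
    by (rule fin_spec_compose_projection[OF fin_spec_add_projection[OF E(2)] r_idem])
      (auto simp: commutes_add commutes_scaleR rE commutes_sym[of id_blinfun] intro: blinfun_eqI)
  have adjD: "adj D = D"
    using rE by (simp add: D_def adj_compose adj_r adj_add adj_scaleR E commutes_def)
      (rule blinfun_eqI, simp add: blinfun.bilinear_simps commutes_apply[OF rE])
  have rD: "r (D x) = D x" for x using commutes_apply[OF XD[OF rG]] by (simp add: D_def rr)
  have Dr: "D (r x) = D x" for x by (simp add: D_def rr)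
  have Dp: "D (p x) = 0" for x by (simp add: D_def rp)
  define S where "S = V o\<^sub>L D"
  have SS: "adj S o\<^sub>L S = D o\<^sub>L D"
    by (rule blinfun_eqI) (simp add: S_def adj_compose adjVV rD adjD)
  \<comment> \<open>As with \<open>H\<close>, the summand \<open>p\<close> fills up the kernel of
    \<open>D\<close>; \<open>W\<close> inverts \<open>D\<close> on the range of
    \<open>r\<close>.\<close>
  obtain W where W: "W o\<^sub>L (D + p) = id_blinfun" "(D + p) o\<^sub>L W = id_blinfun"
  proof (rule inverse_of_form_bounded_below)
    show "adj (D + p) = D + p" by (simp add: adj_add adjD adj_p)
    show "h * (x \<bullet> x) \<le> (D + p) x \<bullet> x" for x
    proof -
      have "D x \<bullet> x = D (r x) \<bullet> r x" using form_r[OF XD[OF rG], of x] by (simp add: Dr)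
      also have "\<dots> = E (r x) \<bullet> r x + h * (r x \<bullet> r x)"
        by (simp add: D_def blinfun.bilinear_simps inner_simps rr)
      finally have "h * (r x \<bullet> r x) \<le> D x \<bullet> x" using E(4)[of "r x"] by simp
      from hle[OF this] show ?thesis by (simp add: blinfun.bilinear_simps inner_simps pxx)
    qed
  qed (use h in auto)
  have WD: "W (D x) = r x" for x
  proof -
    have "D x = (D + p) (r x)" by (simp add: blinfun.bilinear_simps Dr pr)
    then show ?thesis using W(1) by (metis blinfun_apply_blinfun_compose blinfun_apply_id_blinfun id_apply)
  qed
  have XW: "commutes X W" if "commutes X G" for X
    using commutes_inverse[OF _ W] that by (simp add: commutes_add XD Xp)
  define S' where "S' = W o\<^sub>L adj V"
  have 3: "S o\<^sub>L S' o\<^sub>L S = S"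
    by (rule blinfun_eqI) (simp add: S_def S'_def adjVV rD WD Dr)
  have 4: "commutes X S \<and> commutes X S'" if X: "commutes X T" "commutes X (adj T)" for X
  proof -
    have XG: "commutes X G" using X by (intro G(4)) (simp add: commutes_compose)
    have "adj V = r o\<^sub>L (Z o\<^sub>L adj T)"
    proof -
      have "adj H = H" by (simp add: H_def adj_add adjGr adj_p)
      then have "adj Z = Z" using adj_inverse Z by blast
      then show ?thesis by (simp add: V_def adj_compose adj_r)
    qed
    then have "commutes X V" "commutes X (adj V)"
      using X by (simp_all add: V_def commutes_compose XZ[OF XG] Xr[OF XG])
    then show ?thesis by (simp add: S_def S'_def commutes_compose XD[OF XG] XW[OF XG])
  qed
  have nGp: "norm (G o\<^sub>L p) \<le> h"
  proof (rule norm_le_of_form_bounds)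
    show "adj (G o\<^sub>L p) = G o\<^sub>L p" using pG by (simp add: adj_compose adj_p G commutes_def)
    show "0 \<le> (G o\<^sub>L p) x \<bullet> x" for x using form_p[OF pG, of x] G(3)[of "p x"] by simp
    show "(G o\<^sub>L p) x \<bullet> x \<le> h * (x \<bullet> x)" for x
    proof -
      have "h * (p x \<bullet> p x) \<le> h * (x \<bullet> x)"
        using h norm_split[of x] by (intro mult_left_mono) auto
      then show ?thesis using form_p[OF pG, of x] b1[of x] by simp
    qed
  qed (use h in auto)
  have nGE: "norm (G1 - E) \<le> h"
    using E(5) h by (intro norm_le_of_form_bounds) (auto simp: adj_diff E adjG1)
  have "norm ((T - S) x) \<le> e * norm x" for x
  proof -
    have "norm (T (p x)) = norm ((G o\<^sub>L p) x)" by (simp add: norm_eq_sqrt_inner TG)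
    also have "\<dots> \<le> h * norm x"
      using norm_blinfun[of "G o\<^sub>L p" x] nGp by (meson mult_right_mono norm_ge_zero order_trans)
    finally have 1: "norm (T (p x)) \<le> h * norm x" .
    \<comment> \<open>The two shifts by \<open>h\<close> cancel, so only the rounding error
      remains.\<close>
    have "r (G x - D x) = (G1 - E) (r x)"
      using commutes_apply[OF rG, of x] rD[of x]
      by (simp add: blinfun.bilinear_simps G1_def rr) (simp add: D_def blinfun.bilinear_simps)
    then have "norm (V (G x - D x)) = norm ((G1 - E) (r x))" by (simp add: norm_eq_sqrt_inner VV)
    also have "\<dots> \<le> h * norm (r x)"
      using norm_blinfun[of "G1 - E" "r x"] nGE by (meson mult_right_mono norm_ge_zero order_trans)
    also have "\<dots> \<le> h * norm x"
      using h norm_split[of x] by (intro mult_left_mono) (auto simp: norm_le)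
    finally have 2: "norm (V (G x - D x)) \<le> h * norm x" .
    have "(T - S) x = T (p x) + V (G x - D x)"
      by (simp add: S_def blinfun.bilinear_simps VG r_apply)
    then have "norm ((T - S) x) \<le> h * norm x + h * norm x"
      using norm_triangle_le[OF add_mono[OF 1 2]] by simp
    also have "\<dots> \<le> e * norm x" using mult_right_mono[OF h(3), of "norm x"] by (simp add: algebra_simps)
    finally show ?thesis .
  qed
  then have "norm (T - S) \<le> e" using assms by (intro norm_blinfun_bound) auto
  then show ?thesis using that fin_spec_square[OF fD] SS 3 4 by metis
qed

section \<open>Complex structure\<close>

lemma csubspace_imp_subspace: "complex_vector.subspace M \<Longrightarrow> subspace M"
  by (auto simp: complex_vector.subspace_def subspace_def scaleR_conv_scaleC)

lemma scaleC_decompose: "c *\<^sub>C x = Re c *\<^sub>R x + Im c *\<^sub>R (\<i> *\<^sub>C x)"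
  by (metis complex_eq mult.commute scaleC_add_left scaleC_scaleC scaleR_conv_scaleC)

lemma cinner_add_right: "cinner x (y + z) = cinner x y + cinner x z"
  by (metis cinner_add_left cinner_commute complex_cnj_add)

lemma cinner_scaleC_right: "cinner x (c *\<^sub>C y) = cnj c * cinner x y"
  by (metis cinner_commute cinner_scaleC_left complex_cnj_mult)

lemma cinner_zero_left [simp]: "cinner 0 x = 0"
  by (metis add_cancel_right_right cinner_add_left add.right_neutral)

lemma cinner_zero_right [simp]: "cinner x 0 = 0"
  by (metis cinner_commute cinner_zero_left complex_cnj_zero)

lemma cinner_diff_left: "cinner (x - y) z = cinner x z - cinner y z"
  by (metis add_diff_cancel_right' cinner_add_left diff_add_cancel)

lemma cinner_sum_left: "cinner (\<Sum>i\<in>A. f i) y = (\<Sum>i\<in>A. cinner (f i) y)"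
  by (induction A rule: infinite_finite_induct) (auto simp: cinner_add_left)

lemma cinner_sum_right: "cinner y (\<Sum>i\<in>A. f i) = (\<Sum>i\<in>A. cinner y (f i))"
  by (induction A rule: infinite_finite_induct) (auto simp: cinner_add_right)

lemma Im_cinner: "Im (cinner x y) = x \<bullet> (\<i> *\<^sub>C y)"
  by (simp add: cinner_scaleC_right flip: Re_cinner)

lemma cinner_self_eq_0 [simp]: "cinner x x = 0 \<longleftrightarrow> x = 0"
  by (simp add: cinner_self)

lemma cinner_eq_0_commute: "cinner x y = 0 \<longleftrightarrow> cinner y x = 0"
  by (metis cinner_commute complex_cnj_zero_iff)

lemma cinner_norm1: "norm x = 1 \<Longrightarrow> cinner x x = 1"
  by (metis cinner_self norm_times_norm mult_1 of_real_1)

lemma norm_scaleC: "norm (c *\<^sub>C x) = cmod c * norm x" for x :: "'a::complex_inner"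
proof -
  have "(norm (c *\<^sub>C x))\<^sup>2 = Re (cinner (c *\<^sub>C x) (c *\<^sub>C x))"
    by (simp add: Re_cinner power2_norm_eq_inner)
  also have "\<dots> = Re ((c * cnj c) * of_real (x \<bullet> x))"
    by (simp only: cinner_scaleC_left cinner_scaleC_right cinner_self[of x] mult_ac)
  also have "\<dots> = Re (of_real ((cmod c)\<^sup>2 * (x \<bullet> x)))"
    by (simp only: complex_norm_square of_real_mult)
  also have "\<dots> = (cmod c * norm x)\<^sup>2"
    by (simp only: Re_complex_of_real power_mult_distrib power2_norm_eq_inner)
  finally show ?thesis by (metis norm_ge_zero mult_nonneg_nonneg power2_eq_imp_eq)
qed

lemma norm_cinner_le: "cmod (cinner x y) \<le> norm x * norm y"
proof -
  define z where "z = cinner x y"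
  have "cmod z * cmod z = Re (cnj z * z)"
    by (metis Re_complex_of_real complex_norm_square mult.commute of_real_power power2_eq_square)
  also have "cnj z * z = cinner (cnj z *\<^sub>C x) y" by (simp add: z_def cinner_scaleC_left)
  also have "Re \<dots> \<le> norm (cnj z *\<^sub>C x) * norm y"
    unfolding Re_cinner by (rule norm_cauchy_schwarz)
  also have "\<dots> = cmod z * (norm x * norm y)" by (simp add: norm_scaleC)
  finally show ?thesis unfolding z_def[symmetric] by (cases "z = 0") simp_all
qed

lemma bounded_linear_cinner_left: "bounded_linear (\<lambda>x. cinner x y)"
  by (rule bounded_linear_intro[where K = "norm y"])
    (auto simp: cinner_add_left scaleR_conv_scaleC cinner_scaleC_left norm_cinner_le scaleR_conv_of_real)

lemma bounded_linear_scaleC_right: "bounded_linear (\<lambda>x::'a::complex_inner. c *\<^sub>C x)"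
  by (rule bounded_linear_intro[where K = "cmod c"])
    (auto simp: scaleC_add_right scaleR_conv_scaleC scaleC_scaleC norm_scaleC mult.commute)

lemma bounded_linear_scaleC_left: "bounded_linear (\<lambda>c. c *\<^sub>C x)" for x :: "'a::complex_inner"
  by (rule bounded_linear_intro[where K = "norm x"])
    (auto simp: scaleC_add_left scaleR_conv_scaleC scaleC_scaleC norm_scaleC scaleR_conv_of_real)

definition cmul :: "complex \<Rightarrow> 'a::complex_hilbert \<Rightarrow>\<^sub>L 'a" where
  "cmul c = Blinfun (\<lambda>x. c *\<^sub>C x)"

lemma cmul_apply [simp]: "cmul c x = c *\<^sub>C x"
  by (simp add: cmul_def bounded_linear_Blinfun_apply bounded_linear_scaleC_right)

lemma bounded_ops_iff: "T \<in> bounded_ops \<longleftrightarrow> (\<forall>c x. T (c *\<^sub>C x) = c *\<^sub>C T x)"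
  by (auto simp: bounded_ops_def blinfun.add_right Vector_Spaces.linear_iff
      complex_vector.vector_space_axioms)

lemma bounded_ops_scaleC: "T \<in> bounded_ops \<Longrightarrow> blinfun_apply T (c *\<^sub>C x) = c *\<^sub>C T x"
  by (simp add: bounded_ops_iff)

text \<open>Real linearity is built into the type, so multiplication by the imaginary unit is all
  that has to be checked.\<close>

lemma bounded_ops_iff_commutes: "T \<in> bounded_ops \<longleftrightarrow> commutes (cmul \<i>) T"
proof
  show "T \<in> bounded_ops \<Longrightarrow> commutes (cmul \<i>) T"
    by (rule commutesI) (simp add: bounded_ops_iff)
  assume "commutes (cmul \<i>) T"
  then have "T (\<i> *\<^sub>C x) = \<i> *\<^sub>C T x" for x using commutes_apply by fastforce
  then have "T (c *\<^sub>C x) = c *\<^sub>C T x" for c x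
    unfolding scaleC_decompose[of c x] scaleC_decompose[of c "T x"]
    by (simp add: blinfun.bilinear_simps)
  then show "T \<in> bounded_ops" by (simp add: bounded_ops_iff)
qed

lemma adj_cmul_ii: "adj (cmul \<i>) = - cmul \<i>"
proof (rule adj_unique)
  show "cmul \<i> x \<bullet> y = x \<bullet> (- cmul \<i>) y" for x y :: 'a
    by (simp add: blinfun.minus_left flip: Im_cinner)
      (simp add: cinner_scaleC_left flip: Re_cinner)
qed

lemma bounded_ops_adj: "T \<in> bounded_ops \<Longrightarrow> adj T \<in> bounded_ops"
  using commutes_adj[of "cmul \<i>" T]
  by (simp add: bounded_ops_iff_commutes adj_cmul_ii commutes_def
      bounded_bilinear.minus_left[OF bounded_bilinear_blinfun_compose]
      bounded_bilinear.minus_right[OF bounded_bilinear_blinfun_compose])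

lemma bounded_ops_compose: "S \<in> bounded_ops \<Longrightarrow> T \<in> bounded_ops \<Longrightarrow> S o\<^sub>L T \<in> bounded_ops"
  by (simp add: bounded_ops_iff)

lemma bounded_ops_add: "S \<in> bounded_ops \<Longrightarrow> T \<in> bounded_ops \<Longrightarrow> S + T \<in> bounded_ops"
  by (simp add: bounded_ops_iff blinfun.bilinear_simps scaleC_add_right)

lemma bounded_ops_diff: "S \<in> bounded_ops \<Longrightarrow> T \<in> bounded_ops \<Longrightarrow> S - T \<in> bounded_ops"
  by (simp add: bounded_ops_iff_commutes commutes_diff)

lemma bounded_ops_id: "id_blinfun \<in> bounded_ops"
  by (simp add: bounded_ops_iff)

lemma bounded_ops_cmul: "cmul c \<in> bounded_ops"
  by (simp add: bounded_ops_iff scaleC_scaleC mult.commute)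

lemma bounded_ops_tendsto: "Y \<longlonglongrightarrow> L \<Longrightarrow> (\<And>n. Y n \<in> bounded_ops) \<Longrightarrow> L \<in> bounded_ops"
  using commutes_tendsto bounded_ops_iff_commutes by blast

lemma bounded_ops_inverse:
  "H \<in> bounded_ops \<Longrightarrow> V o\<^sub>L H = id_blinfun \<Longrightarrow> H o\<^sub>L V = id_blinfun \<Longrightarrow> V \<in> bounded_ops"
  using commutes_inverse bounded_ops_iff_commutes by blast

text \<open>The real part is the defining identity of \<open>adj\<close>; the imaginary part is that
  identity at \<open>\<i> *\<^sub>C y\<close>, moved through \<open>adj T\<close> by its complex
  linearity.\<close>

lemma cinner_adj: "T \<in> bounded_ops \<Longrightarrow> cinner (blinfun_apply T x) y = cinner x (adj T y)"
  by (rule complex_eqI)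
    (auto simp: Re_cinner Im_cinner adj bounded_ops_scaleC[OF bounded_ops_adj, symmetric])

lemma cadjoint_eq: "T \<in> bounded_ops \<Longrightarrow> cadjoint T = adj T"
  unfolding cadjoint_def
proof (rule the_equality)
  assume T: "T \<in> bounded_ops"
  then show "adj T \<in> bounded_ops \<and> (\<forall>x y. cinner (T x) y = cinner x (adj T y))"
    by (simp add: bounded_ops_adj cinner_adj)
  fix S assume "S \<in> bounded_ops \<and> (\<forall>x y. cinner (T x) y = cinner x (S y))"
  then have "T x \<bullet> y = x \<bullet> S y" for x y by (simp flip: Re_cinner)
  then show "S = adj T" by (metis adj_unique)
qed

lemma reducesD:
  assumes "reduces M T" "T \<in> bounded_ops"
  shows "complex_vector.subspace M" "closed M" "x \<in> M \<Longrightarrow> T x \<in> M" "x \<in> M \<Longrightarrow> adj T x \<in> M"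
  using assms by (auto simp: reduces_def closed_csubspace_def cadjoint_eq)

text \<open>The squared norm of \<open>S x\<close> is the form of \<open>R\<close> at
  \<open>x\<close>. On \<open>M\<close> this form is smallest, among unit vectors, at an eigenvector
  for the least eigenvalue that \<open>R\<close> has on \<open>M\<close>.\<close>

lemma fin_spec_imp_reducing_min_attaining:
  assumes S: "S \<in> bounded_ops" and fs: "fin_spec (adj S o\<^sub>L S)"
  shows "S \<in> \<M>\<^sub>r"
proof -
  define R where "R = adj S o\<^sub>L S"
  have adjR: "adj R = R" by (simp add: R_def adj_compose)
  have Rx: "R x \<bullet> x = (norm (S x))\<^sup>2" for x
    using adj[of S x "S x"] by (simp add: R_def power2_norm_eq_inner inner_commute)
  obtain A where A: "finite A" "span {v. \<exists>a\<in>A. R v = a *\<^sub>R v} = UNIV"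
    using fs by (auto simp: fin_spec_def R_def)
  have "min_attaining_on M S" if red: "reduces M S" and M0: "M \<noteq> {0}" for M
  proof -
    note red' = reducesD[OF red S]
    have M: "subspace M" "closed M" using red' csubspace_imp_subspace by auto
    have RM: "R x \<in> M" if "x \<in> M" for x using red' that by (simp add: R_def)
    have cR: "commutes R (proj M)" using commutes_proj[OF M, of R] RM adjR by simp
    define E where "E = {v \<in> M. \<exists>a\<in>A. R v = a *\<^sub>R v}"
    have spanE: "x \<in> span E" if "x \<in> M" for x
    proof -
      \<comment> \<open>The projection commutes with \<open>R\<close>, so it sends eigenvectors to
        eigenvectors or to 0, and the images of a spanning set span \<open>M\<close>.\<close>
      have "proj M ` {v. \<exists>a\<in>A. R v = a *\<^sub>R v} \<subseteq> E"
        using proj_props(1)[OF M] commutes_apply[OF cR]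
        by (auto simp: E_def blinfun.bilinear_simps)
      moreover have "span (proj M ` {v. \<exists>a\<in>A. R v = a *\<^sub>R v}) = range (proj M)"
        by (subst linear_span_image[OF bounded_linear.linear[OF blinfun.bounded_linear_right]])
          (simp only: A(2))
      moreover have "x \<in> range (proj M)" by (rule range_eqI) (rule proj_ident[OF M that, symmetric])
      ultimately show ?thesis using span_mono[of "proj M ` {v. \<exists>a\<in>A. R v = a *\<^sub>R v}" E] by blast
    qed
    \<comment> \<open>The summands are grouped by eigenvalue, so that distinct ones become
      orthogonal.\<close>
    have decomp: "\<exists>y. x = (\<Sum>a\<in>A. y a) \<and> (\<forall>a\<in>A. y a \<in> M \<and> R (y a) = a *\<^sub>R y a)"
      if "x \<in> M" for x
      using spanE[OF that]
    proof (induction rule: span_induct_alt)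
      case base
      show ?case using M by (intro exI[of _ "\<lambda>_. 0"]) (auto simp: subspace_0)
    next
      case (step c v x)
      obtain y where y: "x = (\<Sum>a\<in>A. y a)" "\<forall>a\<in>A. y a \<in> M \<and> R (y a) = a *\<^sub>R y a"
        using step by blast
      obtain b where b: "b \<in> A" "R v = b *\<^sub>R v" "v \<in> M" using step by (auto simp: E_def)
      have "c *\<^sub>R v + x = (\<Sum>a\<in>A. (if a = b then c *\<^sub>R v else 0) + y a)"
        using A(1) b by (simp add: sum.distrib y(1))
      moreover have "\<forall>a\<in>A. (if a = b then c *\<^sub>R v else 0) + y a \<in> M \<and>
          R ((if a = b then c *\<^sub>R v else 0) + y a) = a *\<^sub>R ((if a = b then c *\<^sub>R v else 0) + y a)"
        using y b M by (auto simp: subspace_add subspace_scale blinfun.bilinear_simps algebra_simps)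
      ultimately show ?case by blast
    qed
    \<comment> \<open>\<open>A\<close> may contain numbers whose eigenvectors all lie outside
      \<open>M\<close>; the minimum must be taken over those that occur in \<open>M\<close>.\<close>
    define K where "K = {a \<in> A. \<exists>v\<in>M. v \<noteq> 0 \<and> R v = a *\<^sub>R v}"
    have K: "finite K" using A by (simp add: K_def)
    have "K \<noteq> {}"
    proof
      assume "K = {}"
      then have "E \<subseteq> {0}" by (auto simp: K_def E_def)
      then have "span E \<subseteq> {0}" by (rule span_minimal) (rule subspace_single_0)
      then have "M \<subseteq> {0}" using spanE by blast
      then show False using M0 subspace_0[OF M(1)] by blast
    qed
    define m where "m = Min K"
    have "m \<in> K" and mle: "\<And>a. a \<in> K \<Longrightarrow> m \<le> a"
      using K \<open>K \<noteq> {}\<close> by (auto simp: m_def)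
    then obtain v where v: "v \<in> M" "v \<noteq> 0" "R v = m *\<^sub>R v" by (auto simp: K_def)
    define u where "u = (1 / norm v) *\<^sub>R v"
    have u: "u \<in> M" "norm u = 1" "R u = m *\<^sub>R u"
      using v M by (auto simp: u_def subspace_scale blinfun.bilinear_simps)
    have low: "m * (x \<bullet> x) \<le> R x \<bullet> x" if xM: "x \<in> M" for x
    proof -
      obtain y where y: "x = (\<Sum>a\<in>A. y a)" "\<And>a. a \<in> A \<Longrightarrow> y a \<in> M"
        "\<And>a. a \<in> A \<Longrightarrow> R (y a) = a *\<^sub>R y a"
        using decomp[OF xM] by blast
      have orth: "y a \<bullet> y b = 0" if "a \<in> A" "b \<in> A" "b \<noteq> a" for a b
      proof -
        have "R (y a) \<bullet> y b = y a \<bullet> R (y b)" by (simp add: adj adjR)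
        then have "(a - b) * (y a \<bullet> y b) = 0" using y(3) that by (simp add: algebra_simps)
        then show ?thesis using that by simp
      qed
      have yx: "y a \<bullet> x = y a \<bullet> y a" if "a \<in> A" for a
      proof -
        have "y a \<bullet> x = (\<Sum>b\<in>A. y a \<bullet> y b)" by (simp add: y(1) inner_sum_right)
        also have "\<dots> = y a \<bullet> y a + (\<Sum>b\<in>A - {a}. y a \<bullet> y b)"
          by (rule sum.remove[OF A(1) that])
        also have "(\<Sum>b\<in>A - {a}. y a \<bullet> y b) = 0"
          using orth that by (intro sum.neutral) auto
        finally show ?thesis by simp
      qed
      have "R x = (\<Sum>a\<in>A. a *\<^sub>R y a)" using y(3) by (simp add: y(1) blinfun.sum_right)
      then have "R x \<bullet> x = (\<Sum>a\<in>A. a * (y a \<bullet> y a))" by (simp add: inner_sum_left yx)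
      moreover have "x \<bullet> x = (\<Sum>a\<in>A. y a \<bullet> y a)"
        using arg_cong[OF y(1), of "\<lambda>z. z \<bullet> x"] by (simp add: inner_sum_left yx)
      ultimately have "R x \<bullet> x - m * (x \<bullet> x) = (\<Sum>a\<in>A. (a - m) * (y a \<bullet> y a))"
        by (simp add: sum_distrib_left left_diff_distrib sum_subtractf)
      also have "\<dots> \<ge> 0"
      proof (rule sum_nonneg)
        fix a assume a: "a \<in> A"
        show "0 \<le> (a - m) * (y a \<bullet> y a)"
        proof (cases "y a = 0")
          case False
          then have "a \<in> K" using y(2,3) a by (auto simp: K_def)
          then show ?thesis using mle by (intro mult_nonneg_nonneg) auto
        qed simp
      qed
      finally show ?thesis by simp
    qed
    have min: "norm (S u) \<le> norm (S x)" if "x \<in> M" "norm x = 1" for x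
    proof -
      have "u \<bullet> u = 1" "x \<bullet> x = 1" using u(2) that(2) by (simp_all flip: norm_times_norm)
      then have "(norm (S u))\<^sup>2 \<le> (norm (S x))\<^sup>2"
        using low[OF that(1)] u(3) unfolding Rx[symmetric] by simp
      then show ?thesis by (rule power2_le_imp_le) simp
    qed
    have "min_modulus_on M S = norm (S u)"
      unfolding min_modulus_on_def using u min by (intro cInf_eq_minimum) auto
    then show ?thesis unfolding min_attaining_on_def using u by metis
  qed
  then show ?thesis using S by (simp add: reducing_min_attaining_ops_def)
qed

section \<open>Orthogonality and half-spaces\<close>

definition corth :: "'a::complex_inner set \<Rightarrow> 'a set" where
  "corth S = {x. \<forall>s\<in>S. cinner x s = 0}"

lemma csubspace_corth: "complex_vector.subspace (corth S)"
  by (auto simp: corth_def complex_vector.subspace_def cinner_add_left cinner_scaleC_left)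

lemma closed_corth: "closed (corth S)"
proof -
  have "corth S = (\<Inter>s\<in>S. {x. cinner x s = 0})" by (auto simp: corth_def)
  moreover have "closed {x. cinner x s = 0}" for s :: 'a
    by (intro closed_Collect_eq linear_continuous_on bounded_linear_cinner_left continuous_on_const)
  ultimately show ?thesis by auto
qed

lemmas subspace_corth = csubspace_imp_subspace[OF csubspace_corth]

lemma corth_mono: "S \<subseteq> T \<Longrightarrow> corth T \<subseteq> corth S"
  by (auto simp: corth_def)

lemma corth_span: "corth (complex_vector.span B) = corth B"
proof
  have "complex_vector.span B \<subseteq> {x. cinner y x = 0}" if "y \<in> corth B" for y
    using that by (intro complex_vector.span_minimal)
      (auto simp: corth_def complex_vector.subspace_def cinner_add_right cinner_scaleC_right)
  then show "corth B \<subseteq> corth (complex_vector.span B)" by (auto simp: corth_def)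
qed (intro corth_mono complex_vector.span_superset)

lemma bounded_ops_proj:
  assumes "complex_vector.subspace M" "closed M"
  shows "proj M \<in> bounded_ops"
  unfolding bounded_ops_iff_commutes
  using assms csubspace_imp_subspace
  by (intro commutes_proj) (auto simp: adj_cmul_ii blinfun.minus_left complex_vector.subspace_scale
      complex_vector.subspace_neg)

lemma cinner_proj:
  fixes M :: "'a::complex_hilbert set"
  assumes "complex_vector.subspace M" "closed M"
  shows "cinner (proj M x) y = cinner x (proj M y)"
  using cinner_adj[OF bounded_ops_proj[OF assms]] adj_proj[OF csubspace_imp_subspace] assms by metis

text \<open>One orthogonality condition removes at most one dimension: a finite spanning set of the
  smaller space together with one vector \<open>w\<close> violating the condition would span the
  larger one.\<close>

lemma infinite_dim_Int_corth:
  assumes V: "complex_vector.subspace V" "infinite_dim V" and "finite F"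
  shows "infinite_dim (V \<inter> corth F)"
  using \<open>finite F\<close>
proof induction
  case empty
  then show ?case using V by (simp add: corth_def)
next
  case (insert f F)
  let ?W = "V \<inter> corth F"
  have W: "complex_vector.subspace ?W"
    using V csubspace_corth by (intro complex_vector.subspace_inter)
  have eq: "V \<inter> corth (insert f F) = {x \<in> ?W. cinner x f = 0}" by (auto simp: corth_def)
  show ?case
  proof (cases "\<forall>x\<in>?W. cinner x f = 0")
    case True
    then have "{x \<in> ?W. cinner x f = 0} = ?W" by blast
    then show ?thesis using insert eq by simp
  next
    case False
    then obtain w where w: "w \<in> ?W" "cinner w f \<noteq> 0" by blast
    show ?thesis unfolding infinite_dim_def
    proof
      assume "\<exists>B. finite B \<and> B \<subseteq> V \<inter> corth (insert f F) \<and>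
        complex_vector.span B = V \<inter> corth (insert f F)"
      then obtain B where B: "finite B" "complex_vector.span B = {x \<in> ?W. cinner x f = 0}"
        "B \<subseteq> {x \<in> ?W. cinner x f = 0}"
        using eq by auto
      have "complex_vector.span (insert w B) = ?W"
      proof
        show "complex_vector.span (insert w B) \<subseteq> ?W"
          using w(1) B(3) W by (intro complex_vector.span_minimal) auto
        show "?W \<subseteq> complex_vector.span (insert w B)"
        proof
          fix x assume x: "x \<in> ?W"
          have "x - (cinner x f / cinner w f) *\<^sub>C w \<in> ?W"
            using W x w(1) by (intro complex_vector.subspace_diff complex_vector.subspace_scale)
          moreover have "cinner (x - (cinner x f / cinner w f) *\<^sub>C w) f = 0"
            using w(2) by (simp add: cinner_diff_left cinner_scaleC_left)
          ultimately have "x - (cinner x f / cinner w f) *\<^sub>C w \<in> complex_vector.span B"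
            using B(2) by blast
          then show "x \<in> complex_vector.span (insert w B)"
            by (auto simp: complex_vector.span_insert)
        qed
      qed
      then show False using insert.IH B w(1) unfolding infinite_dim_def
        by (metis (no_types, lifting) finite.insertI insert_subset le_inf_iff mem_Collect_eq subset_iff)
    qed
  qed
qed

lemma infinite_dim_imp_orth_vector:
  assumes "complex_vector.subspace V" "infinite_dim V" "finite F"
  obtains x where "x \<in> V" "x \<noteq> 0" "x \<in> corth F"
proof -
  have "infinite_dim (V \<inter> corth F)" using infinite_dim_Int_corth assms by blast
  then have "V \<inter> corth F \<noteq> {0}"
    unfolding infinite_dim_def by (metis complex_vector.span_empty empty_subsetI finite.emptyI)
  moreover have "0 \<in> V \<inter> corth F"
    using complex_vector.subspace_0[OF assms(1)] complex_vector.subspace_0[OF csubspace_corth] by blast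
  ultimately show ?thesis using that by blast
qed

definition corthonormal :: "(nat \<Rightarrow> 'a::complex_inner) \<Rightarrow> bool" where
  "corthonormal g \<longleftrightarrow> (\<forall>n. norm (g n) = 1) \<and> (\<forall>m n. m \<noteq> n \<longrightarrow> cinner (g m) (g n) = 0)"

lemma infinite_dim_of_corthonormal:
  assumes g: "corthonormal g" and I: "infinite I" and V: "g ` I \<subseteq> V"
  shows "infinite_dim V"
  unfolding infinite_dim_def
proof
  assume "\<exists>B. finite B \<and> B \<subseteq> V \<and> complex_vector.span B = V"
  then obtain B where B: "finite B" "complex_vector.span B = V" by blast
  have "g n \<noteq> 0" for n using g by (metis corthonormal_def norm_zero zero_neq_one)
  then have "inj_on g I" using g by (intro inj_onI) (metis cinner_self_eq_0 corthonormal_def)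
  then have inf: "infinite (g ` I)" using I finite_imageD by blast
  have "complex_vector.independent (g ` I)"
    unfolding complex_vector.dependent_def
  proof
    assume "\<exists>a\<in>g ` I. a \<in> complex_vector.span (g ` I - {a})"
    then obtain n where n: "g n \<in> complex_vector.span (g ` I - {g n})" by blast
    have "g ` I - {g n} \<subseteq> corth {g n}" using g by (auto simp: corth_def corthonormal_def) metis
    then have "complex_vector.span (g ` I - {g n}) \<subseteq> corth {g n}"
      using csubspace_corth by (intro complex_vector.span_minimal)
    then have "cinner (g n) (g n) = 0" using n by (auto simp: corth_def)
    then show False using \<open>g n \<noteq> 0\<close> by simp
  qed
  then show False
    using complex_vector.independent_span_bound[OF B(1)] V B(2) inf by blast
qed

text \<open>If finitely many cosets spanned the quotient, some nonzero \<open>x\<close> in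
  \<open>corth Y\<close> would be orthogonal to their representatives as well, hence to every
  element of every coset in their span, including \<open>x\<close> itself.\<close>

lemma half_spaceI:
  fixes Y :: "'a::complex_hilbert set"
  assumes Y: "closed_csubspace Y" and g: "corthonormal g"
    and even: "\<And>n. even n \<Longrightarrow> g n \<in> Y" and odd: "\<And>n. odd n \<Longrightarrow> g n \<in> corth Y"
  shows "half_space Y"
proof -
  have "infinite {n::nat. even n}" "infinite {n::nat. odd n}"
    unfolding infinite_nat_iff_unbounded_le
    by (metis dvd_triv_left mem_Collect_eq le_add2 mult_2,
        metis even_Suc dvd_triv_left mem_Collect_eq le_Suc_eq le_add2 mult_2)
  then have inf: "infinite_dim Y" "infinite_dim (corth Y)"
    using infinite_dim_of_corthonormal[OF g] even odd by auto
  have sub: "complex_vector.subspace Y" using Y by (simp add: closed_csubspace_def)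
  have "infinite_dim_quotient Y"
    unfolding infinite_dim_quotient_def
  proof
    assume "\<exists>S. finite S \<and> S \<subseteq> quotient_space Y \<and> quotient_span Y S = quotient_space Y"
    then obtain S where S: "finite S" "S \<subseteq> range (coset Y)" "quotient_span Y S = range (coset Y)"
      by (auto simp: quotient_space_def)
    obtain B where B: "finite B" "S = coset Y ` B" using finite_subset_image[OF S(1,2)] by blast
    obtain x where x: "x \<in> corth Y" "x \<noteq> 0" "x \<in> corth B"
      by (rule infinite_dim_imp_orth_vector[OF csubspace_corth inf(2) B(1)])
    have Yx: "cinner y x = 0" if "y \<in> Y" for y
      using x(1) that by (auto simp: corth_def cinner_eq_0_commute[of y])
    have self: "z \<in> coset Y z" for z
      using sub by (auto simp: coset_def complex_vector.subspace_0 intro!: image_eqI[of _ _ 0])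
    have "\<forall>z\<in>C. cinner z x = 0" if "C \<in> quotient_span Y S" for C
      using that
    proof induction
      case zero
      then show ?case by (auto simp: coset_def Yx)
    next
      case (step u y c)
      obtain b where b: "b \<in> B" "coset Y u = coset Y b" using step.hyps(1) B(2) by auto
      then obtain w where "w \<in> Y" "u = b + w" using self[of u] by (auto simp: coset_def)
      then have "cinner u x = 0"
        using b(1) x(3) by (auto simp: cinner_add_left Yx corth_def cinner_eq_0_commute[of b])
      moreover have "cinner y x = 0" using step.IH self by blast
      ultimately show ?case by (auto simp: coset_def cinner_add_left cinner_scaleC_left Yx)
    qed
    then have "cinner x x = 0" using S(3) self[of x] by blast
    then show False using x(2) by simp
  qed
  then show ?thesis using Y inf by (simp add: half_space_def)
qed

section \<open>Approximate eigenvectors\<close>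

lemma scaleC_scaleR: "c *\<^sub>C (r *\<^sub>R x) = r *\<^sub>R (c *\<^sub>C x)"
  by (simp add: scaleR_conv_scaleC scaleC_scaleC mult.commute)

text \<open>
  Otherwise every member of the pencil has an inverse of norm at most \<open>1/d\<close>, which is a bounded
  entire function of the parameter, hence constant.
\<close>

lemma pencil_approx_kernel:
  fixes A P :: "'a::complex_hilbert \<Rightarrow>\<^sub>L 'a"
  assumes ops: "A \<in> bounded_ops" "P \<in> bounded_ops" and "P \<noteq> 0" "d > 0"
    and inv0: "V0 o\<^sub>L (A - (cmul l0 o\<^sub>L P)) = id_blinfun" "(A - (cmul l0 o\<^sub>L P)) o\<^sub>L V0 = id_blinfun"
  obtains l x where "norm x = 1" "norm (A x - l *\<^sub>C P x) < d"
proof (rule ccontr)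
  assume "\<not> thesis"
  then have no: "d \<le> norm (A x - l *\<^sub>C P x)" if "norm x = 1" for x l
    using that \<open>\<And>x l. \<lbrakk>norm x = 1; norm (A x - l *\<^sub>C P x) < d\<rbrakk> \<Longrightarrow> thesis\<close> by (meson not_le)
  define M where "M l = A - (cmul l o\<^sub>L P)" for l
  have Mx: "M l x = A x - l *\<^sub>C P x" for l x by (simp add: M_def blinfun.diff_left)
  have low: "d * norm x \<le> norm (M l x)" for l x
  proof (cases "x = 0")
    case False
    have "d \<le> norm (M l ((1 / norm x) *\<^sub>R x))" using no False by (simp add: Mx)
    also have "\<dots> = norm (M l x) / norm x" by (simp add: blinfun.scaleR_right)
    finally show ?thesis using False by (simp add: field_simps)
  qed simp
  define inv where "inv l V \<longleftrightarrow> V o\<^sub>L M l = id_blinfun \<and> M l o\<^sub>L V = id_blinfun" for l V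
  have VM: "V (M l x) = x" and MV: "M l (V x) = x" if "inv l V" for l V x
    using that unfolding inv_def by (metis blinfun_apply_blinfun_compose blinfun_apply_id_blinfun id_apply)+
  have nV: "norm (V x) \<le> (1/d) * norm x" if "inv l V" for l V x
    using low[of "V x" l] MV[OF that] assms(4) by (simp add: field_simps)
  have nV': "norm V \<le> 1/d" if "inv l V" for l V
    using nV[OF that] assms(4) by (intro norm_blinfun_bound) auto
  \<comment> \<open>A Neumann perturbation. The bound \<open>1/d\<close> holds for all inverses
    alike, so the admissible radius does not depend on \<open>l\<close>.\<close>
  have step: "\<exists>V. inv m V" if V: "inv l V" and lm: "cmod (m - l) * norm P < d" for l m V
  proof -
    define Y where "Y = V o\<^sub>L (cmul (m - l) o\<^sub>L P)"
    have "norm Y \<le> (1/d) * (cmod (m - l) * norm P)"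
    proof (rule norm_blinfun_bound)
      fix x
      have "norm (Y x) \<le> (1/d) * norm ((m - l) *\<^sub>C P x)" unfolding Y_def using nV[OF V] by simp
      also have "\<dots> = (1/d) * cmod (m - l) * norm (P x)" by (simp add: norm_scaleC)
      also have "\<dots> \<le> (1/d) * cmod (m - l) * (norm P * norm x)"
        using assms(4) by (intro mult_left_mono norm_blinfun) auto
      finally show "norm (Y x) \<le> (1/d) * (cmod (m - l) * norm P) * norm x" by simp
    qed (use assms(4) in simp)
    also have "\<dots> < 1" using lm assms(4) by (simp add: field_simps)
    finally obtain W where W: "W o\<^sub>L (id_blinfun - Y) = id_blinfun" "(id_blinfun - Y) o\<^sub>L W = id_blinfun"
      using neumann_inverse by blast
    have Wx: "W (x - Y x) = x" and xW: "W x - Y (W x) = x" for x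
      using arg_cong[OF W(1), of "\<lambda>f. blinfun_apply f x"] arg_cong[OF W(2), of "\<lambda>f. blinfun_apply f x"]
      by (simp_all add: blinfun.diff_left)
    have Mm: "M m x = M l (x - Y x)" for x
      by (simp add: blinfun.diff_right Y_def MV[OF V]) (simp add: Mx complex_vector.scale_left_diff_distrib)
    have "inv m (W o\<^sub>L V)" unfolding inv_def
      by (auto intro!: blinfun_eqI simp: Mm VM[OF V] MV[OF V] Wx xW)
    then show ?thesis by blast
  qed
  define S where "S = {l. \<exists>V. inv l V}"
  define q where "q = d / (norm P + 1)"
  have q: "q > 0" using assms(4) by (simp add: q_def add_nonneg_pos)
  have near: "m \<in> S" if "l \<in> S" "dist l m < q" for l m
  proof -
    have "cmod (m - l) * norm P \<le> q * norm P"
      using that(2) by (intro mult_right_mono) (auto simp: dist_norm norm_minus_commute)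
    also have "\<dots> < d" using assms(4) by (simp add: q_def divide_less_eq add_nonneg_pos)
    finally show ?thesis using that(1) step by (auto simp: S_def)
  qed
  have "open S"
  proof (rule openI)
    show "\<exists>e>0. ball l e \<subseteq> S" if "l \<in> S" for l
      using near[OF that] q by (intro exI[of _ q]) auto
  qed
  \<comment> \<open>The uniform radius \<open>q\<close> also prevents points outside
    \<open>S\<close> from being approached by points of \<open>S\<close>.\<close>
  moreover have "closed S"
    unfolding closed_def
  proof (rule openI)
    show "\<exists>e>0. ball l e \<subseteq> - S" if "l \<in> - S" for l
      using near[of _ l] that q by (intro exI[of _ q]) (auto simp: dist_commute)
  qed
  moreover have "l0 \<in> S" using inv0 by (auto simp: S_def inv_def M_def)
  ultimately have "S = UNIV" using clopen by blast
  then have "\<forall>l. \<exists>V. inv l V" by (auto simp: S_def)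
  then obtain V where V: "\<And>l. inv l (V l)" by metis
  have Vops: "V l \<in> bounded_ops" for l
  proof (rule bounded_ops_inverse)
    show "M l \<in> bounded_ops"
      unfolding M_def by (intro bounded_ops_diff bounded_ops_compose bounded_ops_cmul ops)
  qed (use V[of l] in \<open>auto simp: inv_def\<close>)
  \<comment> \<open>The resolvent identity of the pencil; it yields both continuity and the
    derivative below.\<close>
  have res: "V m x - V l x = (m - l) *\<^sub>C V m (P (V l x))" for l m x
  proof -
    have "V m x = V m (M l (V l x))" by (simp add: MV[OF V])
    also have "M l (V l x) = M m (V l x) + (m - l) *\<^sub>C P (V l x)"
      by (simp add: Mx complex_vector.scale_left_diff_distrib)
    also have "V m \<dots> = V l x + (m - l) *\<^sub>C V m (P (V l x))"
      by (simp add: blinfun.add_right VM[OF V] bounded_ops_scaleC[OF Vops])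
    finally show ?thesis by simp
  qed
  have Vtend: "((\<lambda>m. V m x) \<longlongrightarrow> V l x) (at l)" for l x
  proof (rule Lim_null[THEN iffD2], rule Lim_null_comparison)
    show "\<forall>\<^sub>F m in at l. norm (V m x - V l x) \<le> cmod (m - l) * ((1/d) * norm (P (V l x)))"
      unfolding res norm_scaleC by (intro always_eventually allI mult_left_mono nV[OF V]) simp
    show "((\<lambda>m. cmod (m - l) * ((1/d) * norm (P (V l x)))) \<longlongrightarrow> 0) (at l)"
      using assms(4) by (auto intro!: tendsto_eq_intros)
  qed
  \<comment> \<open>Pairing with fixed vectors reduces the matter to scalar entire functions, to
    which Liouville's theorem applies.\<close>
  have const: "cinner (V 1 x) y = cinner (V 0 x) y" for x y
  proof -
    define g where "g = (\<lambda>l. cinner (V l x) y)"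
    have "(g has_field_derivative cinner (V l (P (V l x))) y) (at l)" for l
      unfolding has_field_derivative_iff
    proof (rule Lim_transform_eventually)
      show "((\<lambda>m. cinner (V m (P (V l x))) y) \<longlongrightarrow> cinner (V l (P (V l x))) y) (at l)"
        by (rule bounded_linear.tendsto[OF bounded_linear_cinner_left Vtend])
      show "\<forall>\<^sub>F m in at l. cinner (V m (P (V l x))) y = (g m - g l) / (m - l)"
        unfolding eventually_at_filter g_def cinner_diff_left[symmetric] res cinner_scaleC_left
        by (intro always_eventually) simp
    qed
    then have hol: "g holomorphic_on UNIV"
      unfolding holomorphic_on_open[OF open_UNIV] by blast
    have "cmod (g l) \<le> (1/d) * norm x * norm y" for l
    proof -
      have "cmod (g l) \<le> norm (V l x) * norm y" unfolding g_def by (rule norm_cinner_le)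
      also have "\<dots> \<le> ((1/d) * norm x) * norm y" by (intro mult_right_mono nV[OF V]) simp
      finally show ?thesis .
    qed
    then have "bounded (range g)" by (auto simp: bounded_iff)
    then have "g constant_on UNIV" by (rule Liouville_theorem[OF hol])
    then show ?thesis unfolding g_def constant_on_def by force
  qed
  \<comment> \<open>Equality of the inverses at 0 and 1 makes the right side of the resolvent
    identity vanish; injectivity of \<open>V 1\<close> leaves \<open>P (V 0 x) = 0\<close>, and
    \<open>x = M 0 z\<close> turns this into \<open>P z = 0\<close>.\<close>
  have "P z = 0" for z
  proof -
    define x where "x = M 0 z"
    have "cinner (V 1 x - V 0 x) (V 1 x - V 0 x) = 0" by (simp only: cinner_diff_left const) simp
    then have "V 1 (P (V 0 x)) = 0" by (simp add: res)
    then have "P (V 0 x) = 0" using MV[OF V, of 1 "P (V 0 x)"] by (simp add: blinfun.zero_right)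
    then show ?thesis by (simp add: x_def VM[OF V])
  qed
  then show False using assms(3) by (metis blinfun_eqI blinfun.zero_left)
qed

text \<open>The compression to \<open>N\<close> is extended by the identity on the complement and
  only its \<open>N\<close> part is shifted by \<open>l\<close>. A vector almost annihilated by this
  pencil must then lie close to \<open>N\<close>, and its normalized projection is the eigenvector
  sought.\<close>

lemma approx_eigenvector:
  fixes T :: "'a::complex_hilbert \<Rightarrow>\<^sub>L 'a"
  assumes T: "T \<in> bounded_ops" and N: "complex_vector.subspace N" "closed N" "N \<noteq> {0}" and "e > 0"
  obtains l x where "x \<in> N" "norm x = 1" "norm (proj N (T x) - l *\<^sub>C x) \<le> e"
proof -
  define P where "P = proj N"
  have Nr: "subspace N" using N csubspace_imp_subspace by blast
  note pr = proj_props[OF Nr N(2), folded P_def] proj_ident[OF Nr N(2), folded P_def]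
    norm_proj_le[OF Nr N(2), folded P_def]
  have PP: "P (P x) = P x" for x using pr by simp
  have Pops: "P \<in> bounded_ops" unfolding P_def by (rule bounded_ops_proj[OF N(1,2)])
  define A where "A = (P o\<^sub>L T o\<^sub>L P) + (id_blinfun - P)"
  have Aops: "A \<in> bounded_ops" unfolding A_def
    by (intro bounded_ops_add bounded_ops_diff bounded_ops_compose bounded_ops_id Pops T)
  define c where "c = norm T + 1"
  have c: "c > 0" by (simp add: c_def add_nonneg_pos)
  define Y where "Y = (1/c) *\<^sub>R (P o\<^sub>L T o\<^sub>L P)"
  have "norm Y \<le> (1/c) * norm T"
  proof (rule norm_blinfun_bound)
    fix x
    have "norm (P (T (P x))) \<le> norm T * norm (P x)" using pr(4) norm_blinfun order_trans by blast
    also have "\<dots> \<le> norm T * norm x" by (intro mult_left_mono pr) simp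
    finally show "norm (Y x) \<le> (1/c) * norm T * norm x"
      using c by (simp add: Y_def blinfun.scaleR_left divide_right_mono)
  qed (use c in simp)
  also have "\<dots> < 1" using c by (simp add: c_def)
  finally obtain W where W: "W o\<^sub>L (id_blinfun - Y) = id_blinfun" "(id_blinfun - Y) o\<^sub>L W = id_blinfun"
    using neumann_inverse by blast
  have Wx: "W (x - Y x) = x" and xW: "W x - Y (W x) = x" for x
    using arg_cong[OF W(1), of "\<lambda>f. blinfun_apply f x"] arg_cong[OF W(2), of "\<lambda>f. blinfun_apply f x"]
    by (simp_all add: blinfun.diff_left)
  define Q Q' where "Q = (id_blinfun - P) - c *\<^sub>R P" and "Q' = (id_blinfun - P) - (1/c) *\<^sub>R P"
  have QQ: "Q' (Q x) = x" "Q (Q' x) = x" for x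
    using c by (simp_all add: Q_def Q'_def blinfun.bilinear_simps PP)
  \<comment> \<open>At the parameter \<open>c\<close>, larger than \<open>norm T\<close>, the pencil
    is invertible: it is the invertible block scaling \<open>Q\<close> times a Neumann perturbation
    of the identity.\<close>
  have "(A - (cmul (of_real c) o\<^sub>L P)) x = Q (x - Y x)" for x
    using c by (simp add: A_def Q_def Y_def blinfun.bilinear_simps PP algebra_simps
        flip: scaleR_conv_scaleC)
  then have inv: "(W o\<^sub>L Q') o\<^sub>L (A - (cmul (of_real c) o\<^sub>L P)) = id_blinfun"
    "(A - (cmul (of_real c) o\<^sub>L P)) o\<^sub>L (W o\<^sub>L Q') = id_blinfun"
    by (auto intro!: blinfun_eqI simp: QQ Wx xW)
  obtain z where "z \<in> N" "z \<noteq> 0" using N complex_vector.subspace_0 by blast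
  then have "P \<noteq> 0" using pr(3) by fastforce
  \<comment> \<open>\<open>d \<le> 1/4\<close> keeps \<open>x\<close> within 1/2 of its projection,
    so normalizing at most doubles the error \<open>d\<close>; \<open>2 * d \<le> e\<close> absorbs
    this.\<close>
  define d where "d = min (e/2) (1/4)"
  have d: "d > 0" "2 * d \<le> e" "d \<le> 1/4" using assms(5) by (auto simp: d_def)
  obtain l x where x: "norm x = 1" "norm (A x - l *\<^sub>C P x) < d"
    using pencil_approx_kernel[OF Aops Pops \<open>P \<noteq> 0\<close> d(1) inv] by blast
  define v where "v = A x - l *\<^sub>C P x"
  have vx: "v = (P (T (P x)) - l *\<^sub>C P x) + (x - P x)"
    by (simp add: v_def A_def blinfun.bilinear_simps)
  have Pv: "P v = P (T (P x)) - l *\<^sub>C P x"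
    unfolding vx by (simp add: blinfun.bilinear_simps bounded_ops_scaleC[OF Pops] PP)
  have nPv: "norm (P v) \<le> d" using pr(4)[of v] x(2) by (simp add: v_def)
  have "x - P x = v - P v" unfolding Pv by (simp add: vx)
  then have "norm (x - P x) \<le> 2 * d"
    using norm_triangle_ineq4[of v "P v"] nPv x(2) by (simp add: v_def)
  then have half: "norm (P x) \<ge> 1/2"
    using x(1) d(3) norm_triangle_ineq2[of x "P x"] by linarith
  define u where "u = (1 / norm (P x)) *\<^sub>R P x"
  have "proj N (T u) - l *\<^sub>C u = (1 / norm (P x)) *\<^sub>R P v"
    by (simp add: u_def Pv P_def[symmetric] blinfun.bilinear_simps scaleR_diff_right
        scaleC_scaleR)
  then have "norm (proj N (T u) - l *\<^sub>C u) = norm (P v) / norm (P x)" by simp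
  also have "\<dots> \<le> d / (1/2)" using nPv half d by (intro frac_le) auto
  also have "\<dots> \<le> e" using d by simp
  finally have "norm (proj N (T u) - l *\<^sub>C u) \<le> e" .
  moreover have "norm u = 1" using half by (auto simp: u_def)
  moreover have "u \<in> N" using pr(1) Nr by (simp add: u_def subspace_scale)
  ultimately show ?thesis using that by blast
qed

section \<open>Invariant half-spaces\<close>

text \<open>Write \<open>W = id - J\<close> and let \<open>L'\<close> be the preimage of
  \<open>L\<close> under \<open>W\<close>. The polar factor of \<open>W\<close> need not map
  \<open>L'\<close> into \<open>L\<close>, so \<open>W\<close> is kept on \<open>L'\<close> only and
  replaced by its inverse adjoint on the complement. The resulting \<open>Z\<close> maps the two
  pieces to orthogonal images, so its modulus preserves \<open>L'\<close>, and the polar factor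
  \<open>U\<close> of \<open>Z\<close> maps \<open>L'\<close> into \<open>Z L'\<close>, which lies
  in \<open>L\<close>.\<close>

lemma isometry_correction:
  fixes J :: "'a::complex_hilbert \<Rightarrow>\<^sub>L 'a"
  assumes J: "J \<in> bounded_ops" "norm J \<le> k" and k: "0 < k" "k \<le> 1/36"
    and L: "closed_csubspace L"
  obtains U where "U \<in> bounded_ops" "\<And>x y. U x \<bullet> U y = x \<bullet> y" "norm (U - id_blinfun) \<le> 16 * k"
    "\<And>x. x - J x \<in> L \<Longrightarrow> U x \<in> L"
proof -
  have J1: "norm J < 1" using J(2) k by linarith
  obtain V where V: "V o\<^sub>L (id_blinfun - J) = id_blinfun" "(id_blinfun - J) o\<^sub>L V = id_blinfun"
    "norm (V - id_blinfun) \<le> norm J / (1 - norm J)"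
    using neumann_inverse[OF J1] by blast
  have VW: "V (x - J x) = x" for x
    using arg_cong[OF V(1), of "\<lambda>f. blinfun_apply f x"] by (simp add: blinfun.diff_left)
  have Wops: "id_blinfun - J \<in> bounded_ops" by (intro bounded_ops_diff bounded_ops_id J)
  have Vops: "V \<in> bounded_ops" by (rule bounded_ops_inverse[OF Wops V(1,2)])
  have "norm J / (1 - norm J) \<le> k / (1/2)" using J k by (intro frac_le) auto
  then have nV: "norm (V - id_blinfun) \<le> 2 * k" using V(3) by simp
  have nV': "norm (adj V - id_blinfun) \<le> 2 * k"
    using norm_adj_le[of "V - id_blinfun"] nV by (simp add: adj_diff)
  define L' where "L' = {x. x - J x \<in> L}"
  have Lsub: "complex_vector.subspace L" and Lcl: "closed L" using L by (auto simp: closed_csubspace_def)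
  have L'sub: "complex_vector.subspace L'"
  proof (rule complex_vector.subspaceI)
    show "0 \<in> L'" using complex_vector.subspace_0[OF Lsub] by (simp add: L'_def)
    show "x + y \<in> L'" if "x \<in> L'" "y \<in> L'" for x y
      using complex_vector.subspace_add[OF Lsub, of "x - J x" "y - J y"] that
      by (simp add: L'_def blinfun.add_right algebra_simps)
    show "c *\<^sub>C x \<in> L'" if "x \<in> L'" for c x
      using complex_vector.subspace_scale[OF Lsub, of "x - J x" c] that
      by (simp add: L'_def bounded_ops_scaleC[OF J(1)] complex_vector.scale_right_diff_distrib)
  qed
  have "L' = (\<lambda>x. x - J x) -` L" by (auto simp: L'_def)
  moreover have "continuous_on UNIV (\<lambda>x. x - J x)" by (intro continuous_intros)
  ultimately have L'cl: "closed L'" using Lcl by (simp add: continuous_closed_vimage continuous_on_eq_continuous_at)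
  note L'r = csubspace_imp_subspace[OF L'sub]
  define Q where "Q = proj L'"
  define r where "r = id_blinfun - Q"
  interpret orth_projection Q r
    by unfold_locales (auto simp: Q_def r_def adj_proj[OF L'r L'cl] proj_ident[OF L'r L'cl]
        proj_props[OF L'r L'cl] intro!: blinfun_eqI)
  have Qin: "Q x \<in> L'" for x by (simp add: Q_def proj_props[OF L'r L'cl])
  have Qid: "x \<in> L' \<Longrightarrow> Q x = x" for x by (simp add: Q_def proj_ident[OF L'r L'cl])
  have Qops: "Q \<in> bounded_ops" unfolding Q_def by (rule bounded_ops_proj[OF L'sub L'cl])
  have rops: "r \<in> bounded_ops" unfolding r_def by (intro bounded_ops_diff bounded_ops_id Qops)
  define Z where "Z = ((id_blinfun - J) o\<^sub>L Q) + (adj V o\<^sub>L r)"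
  have Zops: "Z \<in> bounded_ops" unfolding Z_def
    by (intro bounded_ops_add bounded_ops_compose bounded_ops_adj Wops Vops Qops rops)
  have ZQ: "Z (Q x) = Q x - J (Q x)" and Zr: "Z (r x) = adj V (r x)" for x
    by (simp_all add: Z_def blinfun.bilinear_simps pp rp rr pr)
  define R where "R = adj Z o\<^sub>L Z"
  have adjR: "adj R = R" by (simp add: R_def adj_compose)
  have RZ: "R x \<bullet> y = Z x \<bullet> Z y" for x y by (simp add: R_def adj_left)
  \<comment> \<open>The inverse adjoint is chosen for this: moved across the inner product, it
    cancels \<open>id_blinfun - J\<close> and leaves two orthogonal vectors.\<close>
  have ortho: "Q (r y) = 0 \<Longrightarrow> R (Q x) \<bullet> r y = 0" for x y
  proof -
    have "R (Q x) \<bullet> r y = V (Q x - J (Q x)) \<bullet> r y" unfolding RZ ZQ Zr by (simp add: adj)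
    also have "\<dots> = r (Q x) \<bullet> y" by (simp add: VW inner_r)
    finally show ?thesis by (simp add: rp)
  qed
  have RL': "R x \<in> L'" if "x \<in> L'" for x
  proof -
    have "R (Q x) \<bullet> r (R x) = 0" by (rule ortho) (rule pr)
    then have "R x \<bullet> r (R x) = 0" using Qid[OF that] by simp
    then have "r (R x) \<bullet> r (R x) = 0" by (metis inner_r rr)
    then have "r (R x) = 0" by simp
    then have "R x = Q (R x)" by (simp add: r_apply)
    then show ?thesis using Qin by metis
  qed
  have RQ: "commutes R Q" unfolding Q_def
    using commutes_proj[OF L'r L'cl, of R] RL' adjR by simp
  have nQ: "norm (Q x) \<le> norm x" for x unfolding Q_def by (rule norm_proj_le[OF L'r L'cl])
  have nr: "norm (r x) \<le> norm x" for x using norm_split[of x] by (simp add: norm_le)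
  have nZ: "norm (Z - id_blinfun) \<le> 3 * k"
  proof (rule norm_blinfun_bound)
    fix x
    have eq: "(Z - id_blinfun) x = - J (Q x) + (adj V - id_blinfun) (r x)"
      by (simp add: Z_def blinfun.bilinear_simps) (simp add: r_apply)
    have "norm (- J (Q x)) \<le> k * norm x"
      using norm_blinfun[of J "Q x"] mult_mono[OF J(2) nQ[of x]] k by simp
    moreover have "norm ((adj V - id_blinfun) (r x)) \<le> 2 * k * norm x"
      using norm_blinfun[of "adj V - id_blinfun" "r x"] mult_mono[OF nV' nr[of x]] k by simp
    ultimately have "norm ((Z - id_blinfun) x) \<le> k * norm x + 2 * k * norm x"
      unfolding eq using norm_triangle_mono by blast
    then show "norm ((Z - id_blinfun) x) \<le> 3 * k * norm x" by simp
  qed (use k in simp)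
  define A where "A = id_blinfun - R"
  have adjA: "adj A = A" by (simp add: A_def adj_diff adjR)
  \<comment> \<open>The quadratic term is bounded by \<open>3 * k\<close>. Together with
    \<open>k \<le> 1/36\<close> this gives \<open>norm A \<le> 1/4\<close>, so the inverse square
    root \<open>C\<close> is within \<open>12 * k\<close> of the identity.\<close>
  have nA: "norm A \<le> 9 * k"
  proof -
    define E where "E = Z - id_blinfun"
    have A_E: "A = - (adj E + E + (adj E o\<^sub>L E))"
      by (rule blinfun_eqI) (simp add: A_def R_def E_def adj_diff blinfun.bilinear_simps)
    have nE: "norm E \<le> 3 * k" "norm (adj E) \<le> 3 * k"
      using nZ norm_adj_le[of E] by (auto simp: E_def)
    have "norm A \<le> norm (adj E) + norm E + norm (adj E o\<^sub>L E)"
      using norm_triangle_ineq[of "adj E + E" "adj E o\<^sub>L E"] norm_triangle_ineq[of "adj E" E]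
      unfolding A_E norm_minus_cancel by linarith
    also have "norm (adj E o\<^sub>L E) \<le> norm (adj E) * norm E" by (rule norm_blinfun_compose)
    also have "\<dots> \<le> (3 * k) * 1" using nE k by (intro mult_mono) auto
    finally show ?thesis using nE by simp
  qed
  have "norm A \<le> 1" using nA k by linarith
  then obtain Y where Y: "adj Y = Y" "norm Y \<le> norm A"
    "(id_blinfun - Y) o\<^sub>L (id_blinfun - Y) = id_blinfun - A" "\<And>X. commutes X A \<Longrightarrow> commutes X Y"
    using sqrt_one_minus[OF adjA] by blast
  have nY: "norm Y \<le> 9 * k" using Y(2) nA by linarith
  then have "norm Y < 1" using k by linarith
  then obtain C where C: "C o\<^sub>L (id_blinfun - Y) = id_blinfun" "(id_blinfun - Y) o\<^sub>L C = id_blinfun"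
    "norm (C - id_blinfun) \<le> norm Y / (1 - norm Y)"
    using neumann_inverse by blast
  have "norm Y / (1 - norm Y) \<le> (9 * k) / (3/4)" using nY k by (intro frac_le) auto
  then have nC: "norm (C - id_blinfun) \<le> 12 * k" using C(3) by simp
  have XC: "commutes X C" if "commutes X A" for X
    using commutes_inverse[OF _ C(1,2)] that by (simp add: commutes_diff Y)
  \<comment> \<open>\<open>C\<close> is the inverse square root of \<open>R\<close>, so
    \<open>U\<close> is the isometric polar factor of \<open>Z\<close>.\<close>
  define U where "U = Z o\<^sub>L C"
  show ?thesis
  proof (rule that)
    have "A \<in> bounded_ops" unfolding A_def R_def
      by (intro bounded_ops_diff bounded_ops_id bounded_ops_compose bounded_ops_adj Zops)
    then have "C \<in> bounded_ops" using XC by (simp add: bounded_ops_iff_commutes)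
    then show "U \<in> bounded_ops" unfolding U_def by (intro bounded_ops_compose Zops)
    show "U x \<bullet> U y = x \<bullet> y" for x y
    proof -
      have D: "(id_blinfun - Y) (C z) = z" for z
        using arg_cong[OF C(2), of "\<lambda>f. blinfun_apply f z"] by simp
      have "R = (id_blinfun - Y) o\<^sub>L (id_blinfun - Y)" unfolding Y(3) by (simp add: A_def)
      then have "U x \<bullet> U y = (id_blinfun - Y) ((id_blinfun - Y) (C x)) \<bullet> C y"
        by (simp add: U_def flip: RZ)
      also have "\<dots> = (id_blinfun - Y) (C x) \<bullet> (id_blinfun - Y) (C y)"
        by (simp only: adj adj_diff adj_id Y(1))
      finally show ?thesis by (simp only: D)
    qed
    have UC: "U - id_blinfun = ((Z - id_blinfun) o\<^sub>L C) + (C - id_blinfun)"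
      by (rule blinfun_eqI) (simp add: U_def blinfun.bilinear_simps)
    have "norm C \<le> norm (C - id_blinfun) + norm (id_blinfun :: 'a \<Rightarrow>\<^sub>L 'a)"
      by (metis diff_add_cancel norm_triangle_ineq)
    then have "norm C \<le> 4/3" using nC k norm_blinfun_id_le[where 'a = 'a] by linarith
    have "norm (U - id_blinfun) \<le> norm (Z - id_blinfun) * norm C + norm (C - id_blinfun)"
      using norm_triangle_ineq[of "(Z - id_blinfun) o\<^sub>L C" "C - id_blinfun"]
        norm_blinfun_compose[of "Z - id_blinfun" C]
      unfolding UC by linarith
    also have "norm (Z - id_blinfun) * norm C \<le> (3 * k) * (4/3)"
      using nZ \<open>norm C \<le> 4/3\<close> k by (intro mult_mono) auto
    finally show "norm (U - id_blinfun) \<le> 16 * k" using nC by simp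
    show "U x \<in> L" if "x - J x \<in> L" for x
    proof -
      have "commutes Q R" using RQ commutes_sym by blast
      then have "commutes Q A" by (simp add: A_def commutes_diff)
      then have "C (Q x) = Q (C x)" using XC commutes_apply by metis
      moreover have "Q x = x" using that by (intro Qid) (simp add: L'_def)
      ultimately have "C x = Q (C x)" by simp
      then have "U x = Q (C x) - J (Q (C x))" using ZQ by (metis U_def blinfun_apply_blinfun_compose)
      then show ?thesis using Qin[of "C x"] by (simp add: L'_def)
    qed
  qed
qed

section \<open>Rank-one operators and triangular perturbations\<close>

definition rank1 :: "'a::complex_hilbert \<Rightarrow> 'a \<Rightarrow> 'a \<Rightarrow>\<^sub>L 'a" where
  "rank1 a b = Blinfun (\<lambda>x. cinner x b *\<^sub>C a)"

lemma rank1_apply [simp]: "rank1 a b x = cinner x b *\<^sub>C a"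
  unfolding rank1_def
  by (subst bounded_linear_Blinfun_apply)
    (auto intro: bounded_linear_compose[OF bounded_linear_scaleC_left bounded_linear_cinner_left])

lemma norm_rank1_le: "norm (rank1 a b) \<le> norm a * norm b"
proof (rule norm_blinfun_bound)
  show "norm (rank1 a b x) \<le> norm a * norm b * norm x" for x
    using mult_right_mono[OF norm_cinner_le[of x b] norm_ge_zero[of a]]
    by (simp add: norm_scaleC mult_ac)
qed simp

lemma bounded_ops_rank1: "rank1 a b \<in> bounded_ops"
  by (simp add: bounded_ops_iff cinner_scaleC_left scaleC_scaleC)

text \<open>Dependent choice: in the predicate \<open>P\<close>, the set argument stands for the
  finitely many vectors already chosen.\<close>

lemma corthonormal_sequence_exists:
  fixes P :: "nat \<Rightarrow> 'a set \<Rightarrow> 'a::complex_inner \<Rightarrow> bool"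
  assumes "\<And>n F. finite F \<Longrightarrow> \<exists>e. norm e = 1 \<and> e \<in> corth F \<and> P n F e"
  obtains g where "corthonormal g" "\<And>n. P n (g ` {..<n}) (g n)"
proof -
  have "\<exists>g. \<forall>n. norm (g n) = 1 \<and> g n \<in> corth (g ` {..<n}) \<and> P n (g ` {..<n}) (g n)"
  proof (rule dependent_wellorder_choice)
    show "(norm r = 1 \<and> r \<in> corth (f ` {..<n}) \<and> P n (f ` {..<n}) r) =
        (norm r = 1 \<and> r \<in> corth (g ` {..<n}) \<and> P n (g ` {..<n}) r)"
      if "\<And>y. y < n \<Longrightarrow> f y = g y" for r f g and n :: nat
    proof -
      have "f ` {..<n} = g ` {..<n}" using that by (intro image_cong) auto
      then show ?thesis by simp
    qed
  qed (use assms in blast)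
  then obtain g where g: "\<And>n. norm (g n) = 1" "\<And>n. g n \<in> corth (g ` {..<n})"
    "\<And>n. P n (g ` {..<n}) (g n)" by blast
  have less: "cinner (g n) (g m) = 0" if "m < n" for m n
    using g(2)[of n] that by (auto simp: corth_def)
  have "cinner (g m) (g n) = 0" if "m \<noteq> n" for m n
    using less[of m n] less[of n m] that cinner_eq_0_commute nat_neq_iff by metis
  then show ?thesis by (intro that[of g]) (auto simp: corthonormal_def g)
qed

text \<open>
  With respect to the flag \<open>g 0, g 2, \<dots>; (rest); \<dots>, g 3, g 1\<close> the perturbed operator is upper triangular:
  a vector of even index is an approximate eigenvector of the compression of the operator to the
  complement of all earlier vectors, and a vector of odd index one of the compressed adjoint.
\<close>

lemma triangular_perturbation:
  fixes T :: "'a::complex_hilbert \<Rightarrow>\<^sub>L 'a"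
  assumes T: "T \<in> bounded_ops" and N: "\<And>x. x \<in> N \<Longrightarrow> T x = 0"
    and inf: "\<And>F. finite F \<Longrightarrow> corth (N \<union> F) \<noteq> {0}" and "e > 0"
  obtains g K where "corthonormal g" "\<And>n. g n \<in> corth N" "K \<in> bounded_ops" "norm K \<le> e"
    "\<And>x. x \<in> N \<Longrightarrow> K x = 0"
    "\<And>x j. (\<And>j. odd j \<Longrightarrow> cinner x (g j) = 0) \<Longrightarrow> odd j \<Longrightarrow> cinner (T x - K x) (g j) = 0"
proof -
  define A where "A n = (if even n then T else adj T)" for n :: nat
  have Aops: "A n \<in> bounded_ops" for n using T bounded_ops_adj by (auto simp: A_def)
  \<comment> \<open>The tolerances sum to \<open>e\<close>, the norm allowed for the total
    perturbation.\<close>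
  define ep where "ep n = e * (1/2) ^ Suc n" for n :: nat
  have ep: "ep n > 0" for n using assms(4) by (simp add: ep_def)
  define H where "H F = corth (N \<union> F)" for F
  have Hs: "complex_vector.subspace (H F)" "closed (H F)" "subspace (H F)" for F
    unfolding H_def by (rule csubspace_corth closed_corth subspace_corth)+
  have ex: "\<exists>u. norm u = 1 \<and> u \<in> corth F \<and> (u \<in> corth N \<and> norm (proj (H (insert u F)) (A n u)) \<le> ep n)"
    if "finite F" for n F
  proof -
    have "H F \<noteq> {0}" using inf that by (simp add: H_def)
    then obtain l u where u: "u \<in> H F" "norm u = 1" "norm (proj (H F) (A n u) - l *\<^sub>C u) \<le> ep n"
      using approx_eigenvector[OF Aops Hs(1,2) _ ep] by blast
    have sub: "H (insert u F) \<subseteq> H F" unfolding H_def by (intro corth_mono) blast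
    let ?P = "proj (H (insert u F))"
    \<comment> \<open>Passing to vectors that are also orthogonal to \<open>u\<close> removes the
      multiple \<open>l *\<^sub>C u\<close>, so the compressed image of \<open>u\<close> is no
      larger than the eigenvector error.\<close>
    have "?P (proj (H F) (A n u) - l *\<^sub>C u) = ?P (A n u)"
    proof (rule proj_unique[OF Hs(3,2)])
      show "?P (A n u) \<in> H (insert u F)" by (rule proj_props[OF Hs(3,2)])
      fix y assume y: "y \<in> H (insert u F)"
      have 1: "(A n u - proj (H F) (A n u)) \<bullet> y = 0"
        using y sub proj_props[OF Hs(3,2)] by blast
      have 2: "(A n u - ?P (A n u)) \<bullet> y = 0" using y proj_props[OF Hs(3,2)] by blast
      have "cinner y u = 0" using y by (simp add: H_def corth_def)
      then have "cinner (l *\<^sub>C u) y = 0" by (simp add: cinner_scaleC_left cinner_eq_0_commute[of u])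
      then have "(l *\<^sub>C u) \<bullet> y = 0" by (simp flip: Re_cinner)
      then show "(proj (H F) (A n u) - l *\<^sub>C u - ?P (A n u)) \<bullet> y = 0"
        using 1 2 by (simp add: inner_diff_left)
    qed
    then have "norm (?P (A n u)) \<le> ep n"
      using norm_proj_le[OF Hs(3,2), of "insert u F" "proj (H F) (A n u) - l *\<^sub>C u"] u(3) by simp
    then show ?thesis using u by (auto simp: H_def corth_def)
  qed
  obtain g where g: "corthonormal g"
    "\<And>n. g n \<in> corth N \<and> norm (proj (H (insert (g n) (g ` {..<n}))) (A n (g n))) \<le> ep n"
    by (rule corthonormal_sequence_exists[where P = "\<lambda>n F u. u \<in> corth N \<and>
          norm (proj (H (insert u F)) (A n u)) \<le> ep n", OF ex]) blast+
  have gg: "cinner (g m) (g n) = (if m = n then 1 else 0)" for m n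
    using g(1) cinner_norm1 by (auto simp: corthonormal_def)
  define B where "B n = H (g ` {..n})" for n
  have Bs: "complex_vector.subspace (B n)" "closed (B n)" "subspace (B n)" for n
    unfolding B_def by (rule Hs)+
  define r where "r n = proj (B n) (A n (g n))" for n
  have nr: "norm (r n) \<le> ep n" for n
  proof -
    have "{..n} = insert n {..<n}" by auto
    then show ?thesis using g(2)[of n] by (simp add: r_def B_def)
  qed
  have rB: "r n \<in> B n" for n unfolding r_def by (rule proj_props[OF Bs(3,2)])
  have gN: "cinner (g n) x = 0" "cinner x (g n) = 0" if "x \<in> N" for n x
    using g(2)[of n] that cinner_eq_0_commute by (auto simp: corth_def)
  have rN: "cinner (r n) x = 0" "cinner x (r n) = 0" if "x \<in> N" for n x
    using rB[of n] that cinner_eq_0_commute by (auto simp: B_def H_def corth_def)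
  have rg: "cinner (r n) (g m) = 0" if "m \<le> n" for m n
    using rB[of n] that by (auto simp: B_def H_def corth_def)
  have gB: "g m \<in> B n" if "n < m" for m n
    using that gN by (auto simp: B_def H_def corth_def gg)
  \<comment> \<open>Each summand cancels the remainder \<open>r n\<close>: on the side of
    \<open>T\<close> for even \<open>n\<close>, on the side of its adjoint for odd
    \<open>n\<close>.\<close>
  define k where "k n = (if even n then rank1 (r n) (g n) else rank1 (g n) (r n))" for n
  have nk: "norm (k n) \<le> ep n" for n
  proof -
    have "norm (k n) \<le> norm (r n) * norm (g n)"
      using norm_rank1_le[of "r n" "g n"] norm_rank1_le[of "g n" "r n"] by (auto simp: k_def mult.commute)
    then show ?thesis using g(1) nr[of n] by (simp add: corthonormal_def)
  qed
  have eps: "ep sums e"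
  proof -
    have "ep = (\<lambda>n. e * (1/2) ^ Suc n)" by (rule ext) (simp add: ep_def)
    then show ?thesis using sums_mult[OF power_half_series, of e] by simp
  qed
  have sk: "summable k" 
    by (rule summable_comparison_test'[OF sums_summable[OF eps]]) (rule nk)
  define K where "K = suminf k"
  have ksums: "k sums K" using sk by (simp add: K_def summable_sums)
  have Kx: "(\<lambda>n. k n x) sums K x" for x
    by (rule bounded_linear.sums[OF blinfun.bounded_linear_left[of x] ksums])
  show ?thesis
  proof (rule that[OF g(1)])
    show "g n \<in> corth N" for n using g(2) by blast
    have "norm K \<le> suminf ep" unfolding K_def
      using nk eps by (intro norm_suminf_le) (auto simp: sums_iff)
    then show "norm K \<le> e" using eps by (simp add: sums_iff)
    have "(\<lambda>n. \<Sum>i<n. k i) \<longlonglongrightarrow> K" using ksums by (simp add: sums_def)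
    moreover have "(\<Sum>i<n. k i) \<in> bounded_ops" for n
      by (induction n) (auto simp: k_def bounded_ops_rank1 intro!: bounded_ops_add,
          simp add: bounded_ops_iff)
    ultimately show "K \<in> bounded_ops" by (rule bounded_ops_tendsto)
    show "K x = 0" if "x \<in> N" for x
    proof -
      have "k n x = 0" for n using gN[OF that] rN[OF that] by (simp add: k_def)
      then have "(\<lambda>n. 0) sums K x" using Kx[of x] by simp
      then show ?thesis using sums_unique2[OF _ sums_zero] by blast
    qed
    show "cinner (T x - K x) (g j) = 0"
      if x: "\<And>j. odd j \<Longrightarrow> cinner x (g j) = 0" and j: "odd j" for x j
    proof -
      have "(\<lambda>n. cinner (k n x) (g j)) sums cinner (K x) (g j)"
        by (rule bounded_linear.sums[OF bounded_linear_cinner_left Kx])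
      \<comment> \<open>Summands beyond \<open>j\<close> have range spanned by \<open>r n\<close> or
        \<open>g n\<close>, both orthogonal to \<open>g j\<close>.\<close>
      moreover have "(\<lambda>n. cinner (k n x) (g j)) sums (\<Sum>n\<le>j. cinner (k n x) (g j))"
      proof (rule sums_finite)
        fix n assume "n \<notin> {..j}"
        then show "cinner (k n x) (g j) = 0"
          by (auto simp: k_def cinner_scaleC_left rg gg)
      qed simp
      ultimately have 1: "cinner (K x) (g j) = (\<Sum>n\<le>j. cinner (k n x) (g j))"
        using sums_unique2 by blast
      define w where "w = adj T (g j) - r j"
      \<comment> \<open>\<open>w\<close> is orthogonal to \<open>B j\<close>, whereas its residual
        \<open>w'\<close> lies in \<open>B j\<close>. The residual therefore vanishes and
        \<open>w\<close> is a combination of \<open>g 0\<close> up to \<open>g j\<close>.\<close>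
      define w' where "w' = w - (\<Sum>n\<le>j. cinner w (g n) *\<^sub>C g n)"
      have Aj: "A j = adj T" using j by (simp add: A_def)
      have "cinner w' y = 0" if "y \<in> N" for y
      proof -
        have "cinner y (adj T (g j)) = 0"
          using cinner_adj[OF T, of y "g j"] N[OF that] by simp
        then have "cinner (adj T (g j)) y = 0" by (simp add: cinner_eq_0_commute[of _ y])
        then show ?thesis using gN(1)[OF that] rN(1)[OF that]
          by (simp add: w'_def w_def cinner_diff_left cinner_sum_left cinner_scaleC_left)
      qed
      moreover have "cinner w' (g m) = 0" if "m \<le> j" for m
        using that by (simp add: w'_def cinner_diff_left cinner_sum_left cinner_scaleC_left gg
            if_distrib[of "\<lambda>z. _ * z"] cong: if_cong)
      ultimately have w'B: "w' \<in> B j" by (auto simp: B_def H_def corth_def)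
      have "w \<bullet> w' = 0"
        using proj_props(2)[OF Bs(3,2) w'B, of "A j (g j)"] by (simp add: w_def r_def Aj)
      moreover have "(cinner w (g n) *\<^sub>C g n) \<bullet> w' = 0" if "n \<le> j" for n
      proof -
        have "cinner w' (g n) = 0" using w'B that by (auto simp: B_def H_def corth_def)
        then have "cinner (cinner w (g n) *\<^sub>C g n) w' = 0"
          by (simp add: cinner_scaleC_left cinner_eq_0_commute[of "g n"])
        then show ?thesis by (simp flip: Re_cinner)
      qed
      ultimately have "w' \<bullet> w' = 0"
        by (subst (1) w'_def) (simp add: inner_diff_left inner_sum_left)
      then have w: "w = (\<Sum>n\<le>j. cinner w (g n) *\<^sub>C g n)" by (simp add: w'_def)
      have "cinner (T x) (g j) = cinner x w + cinner x (r j)"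
        unfolding cinner_adj[OF T] w_def by (simp flip: cinner_add_right)
      also have "cinner x w = (\<Sum>n\<le>j. cnj (cinner w (g n)) * cinner x (g n))"
        by (subst w) (simp add: cinner_sum_right cinner_scaleC_right)
      also have "\<dots> + cinner x (r j)
          = (\<Sum>n\<le>j. cnj (cinner w (g n)) * cinner x (g n) + (if n = j then cinner x (r j) else 0))"
        by (simp add: sum.distrib)
      also have "\<dots> = (\<Sum>n\<le>j. cinner (k n x) (g j))"
      proof (rule sum.cong)
        fix n assume "n \<in> {..j}"
        then have n: "n \<le> j" by simp
        show "cnj (cinner w (g n)) * cinner x (g n) + (if n = j then cinner x (r j) else 0)
            = cinner (k n x) (g j)"
        proof (cases "even n")
          \<comment> \<open>For even \<open>n < j\<close>, the vector \<open>g j\<close> lies in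
            \<open>B n\<close>, so it sees only the part \<open>r n\<close> of
            \<open>T (g n)\<close>. For odd \<open>n\<close> the hypothesis on \<open>x\<close>
            applies.\<close>
          case True
          then have "n < j" using n j by (metis le_neq_implies_less)
          have "cinner w (g n) = cinner (adj T (g j)) (g n)"
            using rg[OF n] by (simp add: w_def cinner_diff_left)
          then have "cnj (cinner w (g n)) = cinner (T (g n)) (g j)"
            by (metis cinner_adj[OF T] cinner_commute)
          also have "\<dots> = cinner (T (g n)) (proj (B n) (g j))"
            using proj_ident[OF Bs(3,2) gB[OF \<open>n < j\<close>]] by simp
          also have "\<dots> = cinner (r n) (g j)"
            using True by (simp add: r_def A_def cinner_proj[OF Bs(1,2)])
          finally show ?thesis using True \<open>n < j\<close> by (simp add: k_def cinner_scaleC_left)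
        next
          case False
          then show ?thesis using x[of n] by (simp add: k_def cinner_scaleC_left gg)
        qed
      qed simp
      finally show ?thesis using 1 by (simp add: cinner_diff_left)
    qed
  qed
qed

section \<open>Approximants with invariant half-spaces, and density\<close>

lemma has_invariant_half_spaceI:
  fixes T :: "'a::complex_hilbert \<Rightarrow>\<^sub>L 'a"
  assumes "half_space Y" "\<And>x. x \<in> Y \<Longrightarrow> T x \<in> Y"
  shows "has_invariant_half_space T"
  using assms by (auto simp: has_invariant_half_space_def)

lemma has_invariant_half_space_of_kernel:
  fixes S :: "'a::complex_hilbert \<Rightarrow>\<^sub>L 'a"
  assumes S: "S \<in> bounded_ops" and inf: "infinite_dim {x. S x = 0}"
  shows "has_invariant_half_space S"
proof -
  define N where "N = {x. S x = 0}"
  have N: "complex_vector.subspace N" "closed N"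
    by (auto simp: N_def complex_vector.subspace_def blinfun.bilinear_simps bounded_ops_scaleC[OF S]
        intro!: closed_Collect_eq continuous_intros)
  have "\<exists>e. norm e = 1 \<and> e \<in> corth F \<and> e \<in> N" if F: "finite F" for n :: nat and F
  proof -
    obtain x where x: "x \<in> N" "x \<noteq> 0" "x \<in> corth F"
      using infinite_dim_imp_orth_vector[OF N(1) inf[folded N_def] F] by blast
    then have "(1 / norm x) *\<^sub>R x \<in> N \<inter> corth F"
      using subspace_scale[OF csubspace_imp_subspace[OF N(1)]] subspace_scale[OF subspace_corth] by blast
    then show ?thesis using x(2) by (intro exI[of _ "(1 / norm x) *\<^sub>R x"]) auto
  qed
  then obtain g where g: "corthonormal g" "\<And>n. g n \<in> N"
    by (rule corthonormal_sequence_exists[where P = "\<lambda>_ _ e. e \<in> N"]) blast+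
  \<comment> \<open>The even vectors of \<open>g\<close> stay in \<open>Y\<close> and the odd ones
    are orthogonal to it, so dimension and codimension are both infinite; \<open>S\<close> vanishes
    on \<open>Y\<close>.\<close>
  define Y where "Y = N \<inter> corth (g ` {j. odd j})"
  have "half_space Y"
  proof (rule half_spaceI[OF _ g(1)])
    show "closed_csubspace Y" unfolding closed_csubspace_def Y_def
      by (intro conjI complex_vector.subspace_inter closed_Int N csubspace_corth closed_corth)
    show "g n \<in> Y" if "even n" for n
      using g that unfolding Y_def corth_def corthonormal_def by auto metis
    show "g n \<in> corth Y" if "odd n" for n
      using that by (auto simp: Y_def corth_def cinner_eq_0_commute[of "g n"])
  qed
  moreover have "S x \<in> Y" if "x \<in> Y" for x
  proof -
    have "S x = 0" using that by (simp add: Y_def N_def)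
    moreover have "0 \<in> Y" using complex_vector.subspace_0[OF N(1)]
        complex_vector.subspace_0[OF csubspace_corth] by (auto simp: Y_def)
    ultimately show ?thesis by simp
  qed
  ultimately show ?thesis by (rule has_invariant_half_spaceI)
qed

lemma approximation_with_invariant_half_space:
  fixes T :: "'a::complex_hilbert \<Rightarrow>\<^sub>L 'a"
  assumes dim: "infinite_dim (UNIV :: 'a set)" and T: "T \<in> bounded_ops" and e: "e > 0"
  obtains S where "S \<in> \<M>\<^sub>r" "has_invariant_half_space S" "norm (T - S) \<le> e"
proof -
  obtain S S' where S: "norm (T - S) \<le> e / 2" "fin_spec (adj S o\<^sub>L S)" "S o\<^sub>L S' o\<^sub>L S = S"
    "\<And>X. commutes X T \<Longrightarrow> commutes X (adj T) \<Longrightarrow> commutes X S \<and> commutes X S'"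
    using finite_modulus_approximation[of "e / 2" T] e by auto
  have Sops: "S \<in> bounded_ops" "S' \<in> bounded_ops"
    using S(4)[of "cmul \<i>"] T bounded_ops_adj[OF T] by (simp_all add: bounded_ops_iff_commutes)
  define N where "N = {x. S x = 0}"
  show ?thesis
  proof (cases "infinite_dim N")
    case True
    then show ?thesis
      using that[of S] fin_spec_imp_reducing_min_attaining[OF Sops(1) S(2)]
        has_invariant_half_space_of_kernel[OF Sops(1)] S(1) e by (simp add: N_def)
  next
    case False
    then obtain B where B: "finite B" "complex_vector.span B = N" by (auto simp: infinite_dim_def)
    \<comment> \<open>A finite spanning set of the kernel and \<open>F\<close> impose only finitely
      many orthogonality conditions.\<close>
    have inf: "corth (N \<union> F) \<noteq> {0}" if F: "finite F" for F
    proof -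
      obtain x where x: "x \<noteq> 0" "x \<in> corth (B \<union> F)"
        using infinite_dim_imp_orth_vector[OF complex_vector.subspace_UNIV dim, of "B \<union> F"] B(1) F
        by blast
      then have "x \<in> corth N" using corth_span[of B] B(2) by (auto simp: corth_def)
      then have "x \<in> corth (N \<union> F)" using x(2) by (auto simp: corth_def)
      then show ?thesis using x(1) by blast
    qed
    \<comment> \<open>The isometry moves vectors by a factor of at most \<open>16 * k\<close>; the
      second bound keeps this below \<open>e / 2\<close> after multiplication by
      \<open>norm S\<close>.\<close>
    define k where "k = min (1/36) (e / (32 * (norm S + 1)))"
    have k: "0 < k" "k \<le> 1/36"
      using e unfolding k_def by (simp add: add_nonneg_pos, intro min.cobounded1)
    have ke: "16 * k * norm S \<le> e / 2"
    proof -
      have "16 * k * norm S \<le> 16 * (e / (32 * (norm S + 1))) * (norm S + 1)"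
        using e by (intro mult_mono) (auto simp: k_def)
      also have "\<dots> = e / 2"
      proof -
        have "16 * (e / (32 * a)) * a = e / 2" if "a > 0" for a using that by (simp add: field_simps)
        then show ?thesis using norm_ge_zero[of S] by (metis add_nonneg_pos zero_less_one)
      qed
      finally show ?thesis .
    qed
    \<comment> \<open>Chosen so that \<open>J = K o\<^sub>L S'\<close> has norm at most
      \<open>k\<close>.\<close>
    define d where "d = k / (norm S' + 1)"
    have d: "d > 0" using k by (simp add: d_def add_nonneg_pos)
    obtain g K where gK: "corthonormal g" "\<And>n. g n \<in> corth N" "K \<in> bounded_ops" "norm K \<le> d"
      "\<And>x. x \<in> N \<Longrightarrow> K x = 0"
      "\<And>x j. (\<And>j. odd j \<Longrightarrow> cinner x (g j) = 0) \<Longrightarrow> odd j \<Longrightarrow> cinner (S x - K x) (g j) = 0"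
      using triangular_perturbation[OF Sops(1) _ inf d] by (auto simp: N_def)
    define L where "L = corth (g ` {j. odd j})"
    have Lc: "closed_csubspace L" unfolding closed_csubspace_def L_def
      by (intro conjI csubspace_corth closed_corth)
    have "half_space L"
    proof (rule half_spaceI[OF Lc gK(1)])
      show "g n \<in> L" if "even n" for n
        using gK(1) that unfolding L_def corth_def corthonormal_def by auto metis
      show "g n \<in> corth L" if "odd n" for n
        using that by (auto simp: L_def corth_def cinner_eq_0_commute[of "g n"])
    qed
    define J where "J = K o\<^sub>L S'"
    have Jops: "J \<in> bounded_ops" unfolding J_def by (intro bounded_ops_compose gK Sops)
    have "norm J \<le> norm K * norm S'" unfolding J_def by (rule norm_blinfun_compose)
    also have "\<dots> \<le> d * (norm S' + 1)" using gK(4) d by (intro mult_mono) auto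
    also have "\<dots> = k"
    proof -
      have "norm S' + 1 \<noteq> 0" using norm_ge_zero[of S'] by linarith
      then show ?thesis by (simp add: d_def)
    qed
    finally have nJ: "norm J \<le> k" .
    \<comment> \<open>\<open>S' (S x)\<close> and \<open>x\<close> differ by an element of the
      kernel of \<open>S\<close>, on which \<open>K\<close> vanishes.\<close>
    have JS: "J (S x) = K x" for x
    proof -
      have "S (S' (S x)) = S x" using arg_cong[OF S(3), of "\<lambda>f. blinfun_apply f x"] by simp
      then have "S' (S x) - x \<in> N" by (simp add: N_def blinfun.diff_right)
      then have "K (S' (S x) - x) = 0" by (rule gK(5))
      then show ?thesis by (simp add: J_def blinfun.diff_right)
    qed
    obtain U where U: "U \<in> bounded_ops" "\<And>x y. U x \<bullet> U y = x \<bullet> y" "norm (U - id_blinfun) \<le> 16 * k"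
      "\<And>x. x - J x \<in> L \<Longrightarrow> U x \<in> L"
      using isometry_correction[OF Jops nJ k Lc] by blast
    define R where "R = U o\<^sub>L S"
    have Rops: "R \<in> bounded_ops" unfolding R_def by (intro bounded_ops_compose U Sops)
    have "adj U (U x) = x" for x
      by (subst vector_eq_ldot[symmetric]) (simp add: U flip: adj)
    then have "adj R o\<^sub>L R = adj S o\<^sub>L S"
      by (intro blinfun_eqI) (simp add: R_def adj_compose)
    then have "R \<in> \<M>\<^sub>r" using fin_spec_imp_reducing_min_attaining[OF Rops] S(2) by simp
    moreover have "has_invariant_half_space R"
    proof (rule has_invariant_half_spaceI[OF \<open>half_space L\<close>])
      fix x assume "x \<in> L"
      \<comment> \<open>This vector is \<open>S x - J (S x)\<close>, so the correction lemma places
        \<open>U (S x)\<close> in \<open>L\<close>.\<close>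
      then have "S x - K x \<in> L" using gK(6)[of x] by (auto simp: L_def corth_def)
      then show "R x \<in> L" using U(4)[of "S x"] by (simp add: R_def JS)
    qed
    moreover have "norm (T - R) \<le> e"
    proof -
      have eq: "T - R = (T - S) - ((U - id_blinfun) o\<^sub>L S)"
        by (rule blinfun_eqI) (simp add: R_def blinfun.bilinear_simps)
      have "norm ((U - id_blinfun) o\<^sub>L S) \<le> 16 * k * norm S"
        using norm_blinfun_compose[of "U - id_blinfun" S] mult_right_mono[OF U(3) norm_ge_zero[of S]]
        by linarith
      then show ?thesis
        unfolding eq using norm_triangle_ineq4[of "T - S" "(U - id_blinfun) o\<^sub>L S"] S(1) ke
        by linarith
    qed
    ultimately show ?thesis by (rule that)
  qed
qed

theorem corollary5p11:
  assumes "infinite_dim (UNIV :: 'a::complex_hilbert set)"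
    and "separable (UNIV :: 'a set)"
  shows "(top_of_set (bounded_ops :: ('a \<Rightarrow>\<^sub>L 'a) set)) closure_of
           {T \<in> \<M>\<^sub>r. has_invariant_half_space T} = bounded_ops"
proof
  let ?D = "{T \<in> \<M>\<^sub>r. has_invariant_half_space T} :: ('a \<Rightarrow>\<^sub>L 'a) set"
  show "top_of_set bounded_ops closure_of ?D \<subseteq> bounded_ops"
    using closure_of_subset_topspace[of "top_of_set bounded_ops" ?D] by simp
  have "?D \<subseteq> bounded_ops" by (auto simp: reducing_min_attaining_ops_def)
  then have eq: "top_of_set bounded_ops closure_of ?D = bounded_ops \<inter> closure ?D"
    by (simp add: closure_of_subtopology Int_absorb1 inf.absorb2)
  show "bounded_ops \<subseteq> top_of_set bounded_ops closure_of ?D"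
  proof
    fix T :: "'a \<Rightarrow>\<^sub>L 'a" assume T: "T \<in> bounded_ops"
    have "\<exists>S\<in>?D. dist S T < e" if "e > 0" for e
    proof -
      have "e / 2 > 0" using that by simp
      then obtain S where "S \<in> \<M>\<^sub>r" "has_invariant_half_space S" "norm (T - S) \<le> e / 2"
        using approximation_with_invariant_half_space[OF assms(1) T] by blast
      then show ?thesis using that by (auto simp: dist_norm norm_minus_commute intro!: bexI[of _ S])
    qed
    then have "T \<in> closure ?D" by (simp add: closure_approachable)
    then show "T \<in> top_of_set bounded_ops closure_of ?D" using T eq by blast
  qed
qed

end
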